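(* Let $q,t,v,w$ be real with $|q|\le t\le1$, $|v|\le w\le1$, let $n\ge1$, and for $i\in\{1,\dots,n\}$ let $\xi_i\in H_{\mathbb R}\cap D$, $\xi_{\bar i}\in\bar H_{\mathbb R}\cap\bar D$, $\lambda_i,\lambda_{\bar i}\in\mathbb R$, and let $T_i:D\to D$, $T_{\bar i}:\bar D\to\bar D$ be linear operators, where $D\subset H$, $\bar D\subset\bar H$ are dense subspaces. Put $$X_i=\mathbf A_{\xi_i\otimes\xi_{\bar i}}+\mathbf A^*_{\xi_i\otimes\xi_{\bar i}}+p_{T_i\otimes T_{\bar i}}+\lambda_i\lambda_{\bar i}\,I .$$ Then $$\varphi(X_1\cdots X_n)=\sum_{\pi\in\mathcal P^{\otimes}(n)}q^{\mathrm{rc}(\pi|_{[n]})}\,t^{\mathrm{rnest}(\pi|_{[n]})}\,v^{\mathrm{rc}(\pi|_{[\bar n]})}\,w^{\mathrm{rnest}(\pi|_{[\bar n]})}\,R_\pi^{\xi,T}.$$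
   Context: Convention: $0^0=1$. Combinatorics. $[n]=\{1,\dots,n\}$, and $[\bar n]=\{\bar1<\dots<\bar n\}$ is a disjoint copy. In a block with at least two elements, the smallest element is the opener, the largest the closer, the others middle points; one-element blocks are singletons. $\mathcal P^\otimes(n)$, the set of diagonal partitions, is the set of partitions $\pi$ of $[n]\sqcup[\bar n]$ such that each block lies entirely in $[n]$ or entirely in $[\bar n]$, and the sets of openers, of middle points and of singletons of $\pi|_{[n]}$ coincide respectively with those of $\pi|_{[\bar n]}$ under $i\leftrightarrow\bar i$. Hence each block $B\in\pi|_{[n]}$ has a unique conjugate block $\bar B\in\pi|_{[\bar n]}$ starting at the same point; the pairs $B\otimes\bar B=(B,\bar B)$ are the diagonal blocks of $\pi$. An arc of a block $B$ is a pair $(i,j)$ of consecutive elements $i<j$ of $B$. Arcs $(i,j),(i',j')$ cross if $i<i'<j<j'$ or $i'<i<j'<j$; $(i,j)$ nests $(i',j')$ if $i<i'<j'<j$. For a partition $\rho$ of a linearly ordered set, $\mathrm{rc}(\rho)$ is the number of crossing (unordered) pairs of arcs belonging to different blocks, and $\mathrm{rnest}(\rho)$ is the number of (unordered) pairs of arcs belonging to different blocks such that one nests the other. For a diagonal block $\mathbf B=\{i_1<\dots<i_m\}\otimes\{\bar j_1<\dots<\bar j_k\}$ (so $i_1=j_1$) put $R^{\xi,T}(\mathbf B)=\lambda_{i_1}\lambda_{\bar i_1}$ if $\mathbf B$ consists of two singletons, and otherwise $$R^{\xi,T}(\mathbf B)=\langle\xi_{i_1},T_{i_2}\cdots T_{i_{m-1}}\xi_{i_m}\rangle_H\,\langle\xi_{\bar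 j_1},T_{\bar j_2}\cdots T_{\bar j_{k-1}}\xi_{\bar j_k}\rangle_{\bar H}$$ (an empty product of operators is the identity). $R_\pi^{\xi,T}$ is the product of $R^{\xi,T}(\mathbf B)$ over all diagonal blocks $\mathbf B$ of $\pi$. Operators. $H$ and $\bar H$ are two separable complex Hilbert spaces, complexifications of real Hilbert spaces $H_{\mathbb R},\bar H_{\mathbb R}$; inner products are linear in the second variable. ($\bar H$ is just the name of a second space; barred and unbarred objects are unrelated.) On $H^{\otimes n}$ let $$P^{(n)}_{q,t}(\eta_1\otimes\cdots\otimes\eta_n)=\sum_{\sigma\in S_n}q^{l_1(\sigma)}t^{\binom n2-l_1(\sigma)}\,\eta_{\sigma(1)}\otimes\cdots\otimes\eta_{\sigma(n)},$$ $l_1(\sigma)$ being the number of inversions, $P^{(0)}_{q,t}=I$ on $\mathbb C\Omega$; define $P^{(n)}_{v,w}$ on $\bar H^{\otimes n}$ in the same way (vacuum vector $\bar\Omega$). The algebraic diagonal Fock space is $\mathcal F_{\rm dig}=\bigoplus_{n\ge0}H^{\otimes n}\otimes\bar H^{\otimes n}$ (finite sums), with $n=0$ term $\mathbb C\,\Omega\otimes\bar\Omega$, carrying the positive semi-definite form $\langle f,g\rangle_{q,t,v,w}=\delta_{n,m}\langle f,(P^{(n)}_{q,t}\otimes P^{(n)}_{v,w})g\rangle$ for $f$ in degree $m$, $g$ in degree $n$. For $\xi\in H_{\mathbb R}$: $a^*_{q,t}(\xi)\Omega=\xi$, $a^*_{q,t}(\xi)\eta_1\otimes\cdots\otimes\eta_n=\xi\otimes\eta_1\otimes\cdots\otimes\eta_n$,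 $a_{q,t}(\xi)\Omega=0$, $a_{q,t}(\xi)\eta_1\otimes\cdots\otimes\eta_n=\sum_{i=1}^nq^{i-1}t^{n-i}\langle\xi,\eta_i\rangle\,\eta_1\otimes\cdots\otimes\hat\eta_i\otimes\cdots\otimes\eta_n$. For $T:D\to D$: $p_T^{(q,t)}\Omega=0$, $p_T^{(q,t)}(\eta_1\otimes\cdots\otimes\eta_n)=\sum_{i=1}^nq^{i-1}t^{n-i}\,T(\eta_i)\otimes\eta_1\otimes\cdots\otimes\hat\eta_i\otimes\cdots\otimes\eta_n$ for $\eta_j\in D$. Similarly for $a_{v,w},a^*_{v,w},p^{(v,w)}$ over $\bar H$, $\bar D$. On the subspace of $\mathcal F_{\rm dig}$ spanned by $\Omega\otimes\bar\Omega$ and the algebraic tensors in $D^{\otimes n}\otimes\bar D^{\otimes n}$, put $\mathbf A_{\xi\otimes\eta}=a_{q,t}(\xi)\otimes a_{v,w}(\eta)$, $\mathbf A^*_{\xi\otimes\eta}=a^*_{q,t}(\xi)\otimes a^*_{v,w}(\eta)$, $p_{T\otimes\bar T}=p_T^{(q,t)}\otimes p_{\bar T}^{(v,w)}$. The vacuum state is $\varphi(\cdot)=\langle\Omega\otimes\bar\Omega,\ \cdot\ \Omega\otimes\bar\Omega\rangle_{q,t,v,w}$. *)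

theory Defs
  imports "HOL-Analysis.Analysis" "HOL-Combinatorics.Permutations" "HOL-Library.Disjoint_Sets"
begin

section \<open>Diagonal partitions\<close>

definition openers :: "nat set set \<Rightarrow> nat set" where
  "openers \<rho> = {Min B | B. B \<in> \<rho> \<and> card B \<ge> 2}"

definition middle_points :: "nat set set \<Rightarrow> nat set" where
  "middle_points \<rho> = {x. \<exists>B\<in>\<rho>. card B \<ge> 2 \<and> x \<in> B \<and> x \<noteq> Min B \<and> x \<noteq> Max B}"

definition singletons :: "nat set set \<Rightarrow> nat set" where
  "singletons \<rho> = {x. {x} \<in> \<rho>}"

text \<open>The disjoint union of \<open>[n]\<close> and its barred copy is \<open>{1..n} <+> {1..n}\<close>, with \<open>Inl i\<close> for the
  unbarred and \<open>Inr i\<close> for the barred copy of \<open>i\<close>.  The restrictions of a partition to the two copies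
  are pulled back to partitions of \<open>{1..n}\<close>, so that \<open>i\<close> and its barred copy are identified.\<close>

definition left_part :: "(nat + nat) set set \<Rightarrow> nat set set" where
  "left_part \<pi> = {Inl -` B | B. B \<in> \<pi>} - {{}}"

definition right_part :: "(nat + nat) set set \<Rightarrow> nat set set" where
  "right_part \<pi> = {Inr -` B | B. B \<in> \<pi>} - {{}}"

definition diag_partitions :: "nat \<Rightarrow> (nat + nat) set set set" where
  "diag_partitions n = {\<pi>. partition_on ({1..n} <+> {1..n}) \<pi> \<and>
     (\<forall>B\<in>\<pi>. B \<subseteq> range Inl \<or> B \<subseteq> range Inr) \<and>
     openers (left_part \<pi>) = openers (right_part \<pi>) \<and>
     middle_points (left_part \<pi>) = middle_points (right_part \<pi>) \<and>
     singletons (left_part \<pi>) = singletons (right_part \<pi>)}"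

definition diag_blocks :: "(nat + nat) set set \<Rightarrow> (nat set \<times> nat set) set" where
  "diag_blocks \<pi> = {(B, B'). B \<in> left_part \<pi> \<and> B' \<in> right_part \<pi> \<and> Min B = Min B'}"

definition arcs :: "nat set \<Rightarrow> (nat \<times> nat) set" where
  "arcs B = {(i, j). i \<in> B \<and> j \<in> B \<and> i < j \<and> (\<forall>k\<in>B. \<not> (i < k \<and> k < j))}"

definition arcs_cross :: "nat \<times> nat \<Rightarrow> nat \<times> nat \<Rightarrow> bool" where
  "arcs_cross a b \<longleftrightarrow>
     fst a < fst b \<and> fst b < snd a \<and> snd a < snd b \<or>
     fst b < fst a \<and> fst a < snd b \<and> snd b < snd a"

definition arc_nests :: "nat \<times> nat \<Rightarrow> nat \<times> nat \<Rightarrow> bool" where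
  "arc_nests a b \<longleftrightarrow> fst a < fst b \<and> fst b < snd b \<and> snd b < snd a"

definition rc :: "nat set set \<Rightarrow> nat" where
  "rc \<rho> = card {{a, b} | a b. \<exists>B\<in>\<rho>. \<exists>B'\<in>\<rho>. B \<noteq> B' \<and> a \<in> arcs B \<and> b \<in> arcs B' \<and> arcs_cross a b}"

definition rnest :: "nat set set \<Rightarrow> nat" where
  "rnest \<rho> = card {{a, b} | a b. \<exists>B\<in>\<rho>. \<exists>B'\<in>\<rho>. B \<noteq> B' \<and> a \<in> arcs B \<and> b \<in> arcs B' \<and>
     (arc_nests a b \<or> arc_nests b a)}"

section \<open>The complexification of a real Hilbert space\<close>

text \<open>The complexification of a real Hilbert space \<open>'a\<close> is \<open>'a \<times> 'a\<close>, where \<open>(x, y)\<close> stands for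
  \<open>x + \<i> y\<close>.  The library norm and topology of the product type are those of the Hilbert space, see
  \<open>Re_cinner\<close> below.\<close>

type_synonym 'a cplx = "'a \<times> 'a"

definition cscale :: "complex \<Rightarrow> 'a::real_vector cplx \<Rightarrow> 'a cplx" where
  "cscale c u = (Re c *\<^sub>R fst u - Im c *\<^sub>R snd u, Re c *\<^sub>R snd u + Im c *\<^sub>R fst u)"

definition cinner :: "'a::real_inner cplx \<Rightarrow> 'a cplx \<Rightarrow> complex" where
  "cinner u v = Complex (inner (fst u) (fst v) + inner (snd u) (snd v))
                        (inner (fst u) (snd v) - inner (snd u) (fst v))"

definition real_vectors :: "'a::real_vector cplx set" where
  "real_vectors = range (\<lambda>x. (x, 0))"

interpretation cplx: vector_space cscale
  by unfold_locales (auto simp: cscale_def algebra_simps)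

lemma Re_cinner: "Re (cinner u v) = inner u v"
  by (simp add: cinner_def inner_prod_def)

lemma cinner_self: "cinner u u = of_real ((norm u)\<^sup>2)"
  by (simp add: cinner_def complex_eq_iff inner_prod_def inner_commute power2_norm_eq_inner)

lemma cinner_cnj: "cnj (cinner u v) = cinner v u"
  by (simp add: cinner_def complex_eq_iff inner_commute)

lemma cinner_add_right: "cinner u (v + w) = cinner u v + cinner u w"
  by (simp add: cinner_def complex_eq_iff inner_right_distrib)

lemma cinner_scale_right: "cinner u (cscale c v) = c * cinner u v"
  by (simp add: cinner_def cscale_def complex_eq_iff algebra_simps)

definition operator_on :: "'a::real_vector cplx set \<Rightarrow> ('a cplx \<Rightarrow> 'a cplx) \<Rightarrow> bool" where
  "operator_on D T \<longleftrightarrow> T ` D \<subseteq> D \<and>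
     (\<forall>u\<in>D. \<forall>v\<in>D. T (u + v) = T u + T v) \<and> (\<forall>c. \<forall>u\<in>D. T (cscale c u) = cscale c (T u))"

section \<open>Tensors and linear extension\<close>

text \<open>Algebraic tensors are realised as multi-antilinear forms: \<open>tens [u\<^sub>1, \<dots>, u\<^sub>n]\<close> is the form
  whose value at \<open>[f\<^sub>1, \<dots>, f\<^sub>n]\<close> is the inner product of \<open>f\<^sub>1 \<otimes> \<cdots> \<otimes> f\<^sub>n\<close> and \<open>u\<^sub>1 \<otimes> \<cdots> \<otimes> u\<^sub>n\<close>.
  Forms of all degrees live in one function space (the value at lists of another length is \<open>0\<close>), and
  the algebraic Fock space is the linear span of all \<open>tens us\<close>; \<open>tens []\<close> is the vacuum vector.\<close>

definition tens :: "'a::real_inner cplx list \<Rightarrow> 'a cplx list \<Rightarrow> complex" where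
  "tens us = (\<lambda>fs. if length fs = length us
                   then (\<Prod>i<length us. cinner (fs ! i) (us ! i)) else 0)"

text \<open>\<open>F \<otimes> G\<close> is again a form, in two groups of variables.\<close>

definition tprod :: "('x \<Rightarrow> complex) \<Rightarrow> ('y \<Rightarrow> complex) \<Rightarrow> 'x \<times> 'y \<Rightarrow> complex" where
  "tprod F G = (\<lambda>(x, y). F x * G y)"

definition dtens :: "'a::real_inner cplx list \<times> 'b::real_inner cplx list \<Rightarrow>
    'a cplx list \<times> 'b cplx list \<Rightarrow> complex" where
  "dtens uv = tprod (tens (fst uv)) (tens (snd uv))"

text \<open>\<open>lin_ext e I g\<close> is the linear map with \<open>e i \<mapsto> g i\<close> for \<open>i \<in> I\<close>, defined on the linear span of
  \<open>e ` I\<close>.  It is meaningful if linear relations between the \<open>e i\<close> also hold between the \<open>g i\<close>; for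
  the operators defined below this is shown in the last section.\<close>

definition lin_ext :: "('i \<Rightarrow> 'x \<Rightarrow> complex) \<Rightarrow> 'i set \<Rightarrow> ('i \<Rightarrow> 'y \<Rightarrow> complex) \<Rightarrow>
    ('x \<Rightarrow> complex) \<Rightarrow> 'y \<Rightarrow> complex" where
  "lin_ext e I g F = (THE G. \<exists>J c. finite J \<and> J \<subseteq> I \<and>
     F = (\<lambda>x. \<Sum>i\<in>J. c i * e i x) \<and> G = (\<lambda>y. \<Sum>i\<in>J. c i * g i y))"

section \<open>Operators on the algebraic Fock space of one Hilbert space\<close>

text \<open>List positions start at \<open>0\<close>; hence the exponents \<open>i\<close> and \<open>n - 1 - i\<close> in place of
  \<open>i - 1\<close> and \<open>n - i\<close>.\<close>

definition remove_nth :: "nat \<Rightarrow> 'x list \<Rightarrow> 'x list" where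
  "remove_nth i us = take i us @ drop (Suc i) us"

definition creation :: "'a::real_inner cplx \<Rightarrow>
    ('a cplx list \<Rightarrow> complex) \<Rightarrow> 'a cplx list \<Rightarrow> complex" where
  "creation \<xi> = lin_ext tens UNIV (\<lambda>us. tens (\<xi> # us))"

definition annihilation :: "real \<Rightarrow> real \<Rightarrow> 'a::real_inner cplx \<Rightarrow>
    ('a cplx list \<Rightarrow> complex) \<Rightarrow> 'a cplx list \<Rightarrow> complex" where
  "annihilation q t \<xi> = lin_ext tens UNIV (\<lambda>us fs. \<Sum>i<length us.
     of_real (q ^ i * t ^ (length us - 1 - i)) * cinner \<xi> (us ! i) * tens (remove_nth i us) fs)"

definition preservation :: "real \<Rightarrow> real \<Rightarrow> 'a::real_inner cplx set \<Rightarrow> ('a cplx \<Rightarrow> 'a cplx) \<Rightarrow>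
    ('a cplx list \<Rightarrow> complex) \<Rightarrow> 'a cplx list \<Rightarrow> complex" where
  "preservation q t D T = lin_ext tens (lists D) (\<lambda>us fs. \<Sum>i<length us.
     of_real (q ^ i * t ^ (length us - 1 - i)) * tens (T (us ! i) # remove_nth i us) fs)"

definition inversions :: "nat \<Rightarrow> (nat \<Rightarrow> nat) \<Rightarrow> nat" where
  "inversions n \<sigma> = card {(i, j). i < j \<and> j < n \<and> \<sigma> j < \<sigma> i}"

text \<open>\<open>symmetrizer q t\<close> is the direct sum of the \<open>P\<^sup>(\<^sup>n\<^sup>)\<close> over all degrees \<open>n\<close>.\<close>

definition symmetrizer :: "real \<Rightarrow> real \<Rightarrow>
    ('a::real_inner cplx list \<Rightarrow> complex) \<Rightarrow> 'a cplx list \<Rightarrow> complex" where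
  "symmetrizer q t = lin_ext tens UNIV (\<lambda>us fs. \<Sum>\<sigma> | \<sigma> permutes {..<length us}.
     of_real (q ^ inversions (length us) \<sigma> * t ^ ((length us choose 2) - inversions (length us) \<sigma>)) *
     tens (permute_list \<sigma> us) fs)"

section \<open>The algebraic diagonal Fock space\<close>

text \<open>The diagonal Fock space is the span of \<open>dtens ` diag_index UNIV UNIV\<close>, and the domain of the
  operators is the span of \<open>dtens ` diag_index D D'\<close>.\<close>

definition diag_index :: "'a set \<Rightarrow> 'b set \<Rightarrow> ('a list \<times> 'b list) set" where
  "diag_index D D' = {(us, vs). us \<in> lists D \<and> vs \<in> lists D' \<and> length us = length vs}"

definition op_tensor :: "'a::real_inner cplx set \<Rightarrow> 'b::real_inner cplx set \<Rightarrow>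
    (('a cplx list \<Rightarrow> complex) \<Rightarrow> 'a cplx list \<Rightarrow> complex) \<Rightarrow>
    (('b cplx list \<Rightarrow> complex) \<Rightarrow> 'b cplx list \<Rightarrow> complex) \<Rightarrow>
    ('a cplx list \<times> 'b cplx list \<Rightarrow> complex) \<Rightarrow> 'a cplx list \<times> 'b cplx list \<Rightarrow> complex" where
  "op_tensor D D' S S' =
     lin_ext dtens (diag_index D D') (\<lambda>(us, vs). tprod (S (tens us)) (S' (tens vs)))"

definition diag_vacuum ::
    "'a::real_inner cplx list \<times> 'b::real_inner cplx list \<Rightarrow> complex" where
  "diag_vacuum = tprod (tens []) (tens [])"

text \<open>The inner product of the tensor product Hilbert spaces: the sesquilinear extension of
  \<open>\<langle>u\<^sub>1 \<otimes> \<cdots> \<otimes> u\<^sub>m \<otimes> v\<^sub>1 \<otimes> \<cdots> \<otimes> v\<^sub>m, u'\<^sub>1 \<otimes> \<cdots> \<otimes> u'\<^sub>n \<otimes> v'\<^sub>1 \<otimes> \<cdots> \<otimes> v'\<^sub>n\<rangle> =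
  \<delta>\<^sub>m\<^sub>n \<Prod>\<^sub>i \<langle>u\<^sub>i, u'\<^sub>i\<rangle> \<langle>v\<^sub>i, v'\<^sub>i\<rangle>\<close>, the right-hand side being \<open>dtens (us', vs') (us, vs)\<close>.\<close>

definition tensor_inner :: "('a::real_inner cplx list \<times> 'b::real_inner cplx list \<Rightarrow> complex) \<Rightarrow>
    ('a cplx list \<times> 'b cplx list \<Rightarrow> complex) \<Rightarrow> complex" where
  "tensor_inner F G = (THE z. \<exists>J c J' c'.
     finite J \<and> J \<subseteq> diag_index UNIV UNIV \<and> F = (\<lambda>x. \<Sum>i\<in>J. c i * dtens i x) \<and>
     finite J' \<and> J' \<subseteq> diag_index UNIV UNIV \<and> G = (\<lambda>x. \<Sum>j\<in>J'. c' j * dtens j x) \<and>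
     z = (\<Sum>i\<in>J. \<Sum>j\<in>J'. cnj (c i) * c' j * dtens j i))"

definition fock_form :: "real \<Rightarrow> real \<Rightarrow> real \<Rightarrow> real \<Rightarrow>
    ('a::real_inner cplx list \<times> 'b::real_inner cplx list \<Rightarrow> complex) \<Rightarrow>
    ('a cplx list \<times> 'b cplx list \<Rightarrow> complex) \<Rightarrow> complex" where
  "fock_form q t v w F G =
     tensor_inner F (op_tensor UNIV UNIV (symmetrizer q t) (symmetrizer v w) G)"

definition vacuum_state :: "real \<Rightarrow> real \<Rightarrow> real \<Rightarrow> real \<Rightarrow>
    (('a::real_inner cplx list \<times> 'b::real_inner cplx list \<Rightarrow> complex) \<Rightarrow>
      'a cplx list \<times> 'b cplx list \<Rightarrow> complex) \<Rightarrow> complex" where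
  "vacuum_state q t v w X = fock_form q t v w diag_vacuum (X diag_vacuum)"

text \<open>The operator \<open>A + A\<^sup>* + p + \<lambda> \<lambda>' I\<close>; primed arguments belong to the second space.\<close>

definition field_op :: "real \<Rightarrow> real \<Rightarrow> real \<Rightarrow> real \<Rightarrow>
    'a::real_inner cplx set \<Rightarrow> 'b::real_inner cplx set \<Rightarrow>
    'a cplx \<Rightarrow> 'b cplx \<Rightarrow> ('a cplx \<Rightarrow> 'a cplx) \<Rightarrow> ('b cplx \<Rightarrow> 'b cplx) \<Rightarrow> real \<Rightarrow> real \<Rightarrow>
    ('a cplx list \<times> 'b cplx list \<Rightarrow> complex) \<Rightarrow> 'a cplx list \<times> 'b cplx list \<Rightarrow> complex" where
  "field_op q t v w D D' \<xi> \<xi>' T T' l l' F = (\<lambda>x.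
     op_tensor D D' (annihilation q t \<xi>) (annihilation v w \<xi>') F x +
     op_tensor D D' (creation \<xi>) (creation \<xi>') F x +
     op_tensor D D' (preservation q t D T) (preservation v w D' T') F x +
     of_real (l * l') * F x)"

section \<open>Weights of diagonal partitions\<close>

text \<open>\<open>\<langle>\<xi>\<^sub>i\<^sub>1, T\<^sub>i\<^sub>2 \<cdots> T\<^sub>i\<^sub>m\<^sub>-\<^sub>1 \<xi>\<^sub>i\<^sub>m\<rangle>\<close> for a block with elements \<open>i\<^sub>1 < \<cdots> < i\<^sub>m\<close>, \<open>m \<ge> 2\<close>.\<close>

definition block_inner :: "(nat \<Rightarrow> 'a::real_inner cplx) \<Rightarrow> (nat \<Rightarrow> 'a cplx \<Rightarrow> 'a cplx) \<Rightarrow>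
    nat set \<Rightarrow> complex" where
  "block_inner \<xi> T B = (let is = sorted_list_of_set B in
     cinner (\<xi> (hd is)) (foldr T (butlast (tl is)) (\<xi> (last is))))"

definition block_weight :: "(nat \<Rightarrow> 'a::real_inner cplx) \<Rightarrow> (nat \<Rightarrow> 'b::real_inner cplx) \<Rightarrow>
    (nat \<Rightarrow> 'a cplx \<Rightarrow> 'a cplx) \<Rightarrow> (nat \<Rightarrow> 'b cplx \<Rightarrow> 'b cplx) \<Rightarrow>
    (nat \<Rightarrow> real) \<Rightarrow> (nat \<Rightarrow> real) \<Rightarrow> nat set \<times> nat set \<Rightarrow> complex" where
  "block_weight \<xi> \<xi>' T T' l l' = (\<lambda>(B, B').
     if card B = 1 \<and> card B' = 1 then of_real (l (Min B) * l' (Min B'))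
     else block_inner \<xi> T B * block_inner \<xi>' T' B')"

definition partition_weight :: "(nat \<Rightarrow> 'a::real_inner cplx) \<Rightarrow> (nat \<Rightarrow> 'b::real_inner cplx) \<Rightarrow>
    (nat \<Rightarrow> 'a cplx \<Rightarrow> 'a cplx) \<Rightarrow> (nat \<Rightarrow> 'b cplx \<Rightarrow> 'b cplx) \<Rightarrow>
    (nat \<Rightarrow> real) \<Rightarrow> (nat \<Rightarrow> real) \<Rightarrow> (nat + nat) set set \<Rightarrow> complex" where
  "partition_weight \<xi> \<xi>' T T' l l' \<pi> = (\<Prod>b\<in>diag_blocks \<pi>. block_weight \<xi> \<xi>' T T' l l' b)"

section \<open>Well-definedness of the linear extensions\<close>

definition lin_compatible ::
    "('i \<Rightarrow> 'x \<Rightarrow> complex) \<Rightarrow> 'i set \<Rightarrow> ('i \<Rightarrow> 'y \<Rightarrow> complex) \<Rightarrow> bool" where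
  "lin_compatible e I g \<longleftrightarrow> (\<forall>J c. finite J \<longrightarrow> J \<subseteq> I \<longrightarrow>
     (\<forall>x. (\<Sum>i\<in>J. c i * e i x) = 0) \<longrightarrow> (\<forall>y. (\<Sum>i\<in>J. c i * g i y) = 0))"

lemma lin_compatibleI:
  assumes "\<And>J c y. finite J \<Longrightarrow> J \<subseteq> I \<Longrightarrow> (\<And>x. (\<Sum>i\<in>J. c i * e i x) = 0) \<Longrightarrow> (\<Sum>i\<in>J. c i * g i y) = 0"
  shows "lin_compatible e I g"
  unfolding lin_compatible_def using assms by blast

lemma lin_compatibleD:
  assumes "lin_compatible e I g" "finite J" "J \<subseteq> I" "\<And>x. (\<Sum>i\<in>J. c i * e i x) = 0"
  shows "(\<Sum>i\<in>J. c i * g i y) = 0"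
  using assms unfolding lin_compatible_def by blast

lemma lin_compatible_unique:
  assumes "lin_compatible e I g" "finite J" "J \<subseteq> I" "finite K" "K \<subseteq> I"
    and "\<And>x. (\<Sum>i\<in>J. c i * e i x) = (\<Sum>i\<in>K. d i * e i x)"
  shows "(\<Sum>i\<in>J. c i * g i y) = (\<Sum>i\<in>K. d i * g i y)"
proof -
  define b where "b = (\<lambda>i. (if i \<in> J then c i else 0) - (if i \<in> K then d i else 0))"
  have expand: "(\<Sum>i\<in>J \<union> K. b i * h i) = (\<Sum>i\<in>J. c i * h i) - (\<Sum>i\<in>K. d i * h i)" for h :: "'a \<Rightarrow> complex"
  proof -
    have "(\<Sum>i\<in>J \<union> K. (if i \<in> J then c i else 0) * h i) = (\<Sum>i\<in>J. c i * h i)"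
      using assms by (intro sum.mono_neutral_cong_right) auto
    moreover have "(\<Sum>i\<in>J \<union> K. (if i \<in> K then d i else 0) * h i) = (\<Sum>i\<in>K. d i * h i)"
      using assms by (intro sum.mono_neutral_cong_right) auto
    ultimately show ?thesis
      by (simp add: b_def left_diff_distrib sum_subtractf)
  qed
  have "(\<Sum>i\<in>J \<union> K. b i * g i y) = 0"
    by (rule lin_compatibleD[OF assms(1)]) (use assms in \<open>auto simp: expand\<close>)
  then show ?thesis by (simp add: expand)
qed

lemma lin_ext_sum:
  assumes "lin_compatible e I g" "finite J" "J \<subseteq> I"
  shows "lin_ext e I g (\<lambda>x. \<Sum>i\<in>J. c i * e i x) = (\<lambda>y. \<Sum>i\<in>J. c i * g i y)"
  unfolding lin_ext_def
proof (rule the_equality)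
  show "\<exists>K d. finite K \<and> K \<subseteq> I \<and> (\<lambda>x. \<Sum>i\<in>J. c i * e i x) = (\<lambda>x. \<Sum>i\<in>K. d i * e i x) \<and>
     (\<lambda>y. \<Sum>i\<in>J. c i * g i y) = (\<lambda>y. \<Sum>i\<in>K. d i * g i y)"
    using assms by blast
next
  fix G
  assume "\<exists>K d. finite K \<and> K \<subseteq> I \<and> (\<lambda>x. \<Sum>i\<in>J. c i * e i x) = (\<lambda>x. \<Sum>i\<in>K. d i * e i x) \<and>
     G = (\<lambda>y. \<Sum>i\<in>K. d i * g i y)"
  then obtain K d where K: "finite K" "K \<subseteq> I"
    "(\<lambda>x. \<Sum>i\<in>J. c i * e i x) = (\<lambda>x. \<Sum>i\<in>K. d i * e i x)" "G = (\<lambda>y. \<Sum>i\<in>K. d i * g i y)"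
    by blast
  have "(\<Sum>i\<in>J. c i * g i y) = (\<Sum>i\<in>K. d i * g i y)" for y
    by (rule lin_compatible_unique[OF assms K(1,2)]) (use K(3) in \<open>auto dest: fun_cong\<close>)
  then show "G = (\<lambda>y. \<Sum>i\<in>J. c i * g i y)" using K(4) by simp
qed

lemma lin_ext_basis:
  assumes "lin_compatible e I g" "i \<in> I"
  shows "lin_ext e I g (e i) = g i"
  using lin_ext_sum[OF assms(1), of "{i}" "\<lambda>_. 1"] assms(2) by simp

lemma tens_Nil_right: "tens us [] = (if us = [] then 1 else 0)"
  by (auto simp: tens_def)

lemma tens_Cons_Cons: "tens (u # us) (f # fs) = cinner f u * tens us fs"
  by (simp add: tens_def prod.lessThan_Suc_shift del: prod.lessThan_Suc)

lemma tens_insert: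
  assumes "i < length us" "i \<le> length fs"
  shows "tens us (take i fs @ f # drop i fs) = cinner f (us ! i) * tens (remove_nth i us) fs"
  using assms
proof (induction i arbitrary: us fs)
  case 0
  then obtain u us' where "us = u # us'" by (cases us) auto
  then show ?case by (simp add: tens_Cons_Cons remove_nth_def)
next
  case (Suc i)
  obtain u us' where us: "us = u # us'" using Suc.prems by (cases us) auto
  obtain g fs' where fs: "fs = g # fs'" using Suc.prems by (cases fs) auto
  have "remove_nth (Suc i) us = u # remove_nth i us'"
    by (simp add: us remove_nth_def)
  moreover have "tens us' (take i fs' @ f # drop i fs') = cinner f (us' ! i) * tens (remove_nth i us') fs'"
    using Suc.prems by (intro Suc.IH) (auto simp: us fs)
  ultimately show ?case by (simp add: us fs tens_Cons_Cons)
qed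

lemma length_remove_nth: "i < length us \<Longrightarrow> length (remove_nth i us) = length us - 1"
  by (simp add: remove_nth_def)

lemma tens_length: "length us \<noteq> length fs \<Longrightarrow> tens us fs = 0"
  by (auto simp: tens_def)

lemma lin_compatible_creation: "lin_compatible tens UNIV (\<lambda>us. tens (\<xi> # us))"
proof (rule lin_compatibleI)
  fix J :: "'a cplx list set" and c and fs :: "'a cplx list"
  assume 0: "\<And>x. (\<Sum>i\<in>J. c i * tens i x) = 0"
  show "(\<Sum>i\<in>J. c i * tens (\<xi> # i) fs) = 0"
  proof (cases fs)
    case (Cons f fs')
    have "(\<Sum>i\<in>J. c i * tens (\<xi> # i) fs) = cinner f \<xi> * (\<Sum>i\<in>J. c i * tens i fs')"
      by (simp add: Cons tens_Cons_Cons sum_distrib_left mult_ac)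
    then show ?thesis using 0 by simp
  qed (simp add: tens_Nil_right)
qed

lemma creation_tens: "creation \<xi> (tens us) = tens (\<xi> # us)"
  unfolding creation_def by (rule lin_ext_basis[OF lin_compatible_creation]) simp

lemma lin_compatible_annihilation: "lin_compatible tens UNIV (\<lambda>us fs. \<Sum>i<length us.
     of_real (q ^ i * t ^ (length us - 1 - i)) * cinner \<xi> (us ! i) * tens (remove_nth i us) fs)"
proof (rule lin_compatibleI)
  fix J :: "'a cplx list set" and c and fs :: "'a cplx list"
  assume 0: "\<And>x. (\<Sum>i\<in>J. c i * tens i x) = 0"
  have eq: "(\<Sum>i<length us. of_real (q ^ i * t ^ (length us - 1 - i)) * cinner \<xi> (us ! i) * tens (remove_nth i us) fs)
    = (\<Sum>i<Suc (length fs). of_real (q ^ i * t ^ (length fs - i)) * tens us (take i fs @ \<xi> # drop i fs))"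
    for us
  proof (cases "length us = Suc (length fs)")
    case True
    then show ?thesis by (intro sum.cong) (auto simp: tens_insert)
  next
    case False
    then show ?thesis
      by (auto simp: tens_length length_remove_nth intro!: sum.neutral)
  qed
  have "(\<Sum>us\<in>J. c us * (\<Sum>i<length us. of_real (q ^ i * t ^ (length us - 1 - i)) * cinner \<xi> (us ! i) * tens (remove_nth i us) fs))
    = (\<Sum>us\<in>J. \<Sum>i<Suc (length fs). of_real (q ^ i * t ^ (length fs - i)) * (c us * tens us (take i fs @ \<xi> # drop i fs)))"
    unfolding eq sum_distrib_left by (simp add: mult_ac)
  also have "\<dots> = (\<Sum>i<Suc (length fs). of_real (q ^ i * t ^ (length fs - i)) *
      (\<Sum>us\<in>J. c us * tens us (take i fs @ \<xi> # drop i fs)))"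
    by (subst sum.swap) (simp only: sum_distrib_left)
  finally show "(\<Sum>us\<in>J. c us * (\<Sum>i<length us. of_real (q ^ i * t ^ (length us - 1 - i)) * cinner \<xi> (us ! i) * tens (remove_nth i us) fs)) = 0"
    using 0 by simp
qed

lemma annihilation_tens: "annihilation q t \<xi> (tens us) = (\<lambda>fs. \<Sum>i<length us.
     of_real (q ^ i * t ^ (length us - 1 - i)) * cinner \<xi> (us ! i) * tens (remove_nth i us) fs)"
  unfolding annihilation_def by (rule lin_ext_basis[OF lin_compatible_annihilation]) simp

lemma cinner_sum_scale: "cinner f (\<Sum>i\<in>J. cscale (c i) (v i)) = (\<Sum>i\<in>J. c i * cinner f (v i))"
proof (induction J rule: infinite_finite_induct)
  case (insert i J)
  then show ?case by (simp add: cinner_add_right cinner_scale_right)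
qed (simp_all add: cinner_def zero_complex.code)

lemma operator_on_sum:
  assumes "operator_on D T" "cplx.subspace D" "finite J" "\<And>i. i \<in> J \<Longrightarrow> v i \<in> D"
  shows "T (\<Sum>i\<in>J. cscale (c i) (v i)) = (\<Sum>i\<in>J. cscale (c i) (T (v i)))"
  using assms(3,4)
proof (induction J rule: finite_induct)
  case empty
  have "T (cscale 0 0) = cscale 0 (T 0)"
    using assms(1) cplx.subspace_0[OF assms(2)] unfolding operator_on_def by blast
  then show ?case by (simp add: cscale_def zero_prod_def)
next
  case (insert i J)
  have "(\<Sum>i\<in>J. cscale (c i) (v i)) \<in> D" "cscale (c i) (v i) \<in> D"
    using insert.prems assms(2) by (auto intro!: cplx.subspace_sum cplx.subspace_scale)
  then show ?case
    using insert assms(1) by (simp add: operator_on_def)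
qed

lemma lin_compatible_preservation:
  assumes T: "operator_on D T" and D: "cplx.subspace D"
  shows "lin_compatible tens (lists D) (\<lambda>us fs. \<Sum>i<length us.
     of_real (q ^ i * t ^ (length us - 1 - i)) * tens (T (us ! i) # remove_nth i us) fs)"
proof (rule lin_compatibleI)
  fix J :: "'a cplx list set" and c and fs :: "'a cplx list"
  assume J: "finite J" "J \<subseteq> lists D" and 0: "\<And>x. (\<Sum>i\<in>J. c i * tens i x) = 0"
  let ?k = "\<lambda>n i. of_real (q ^ i * t ^ (n - 1 - i)) :: complex"
  let ?s = "\<lambda>us. \<Sum>i<length us. ?k (length us) i * tens (T (us ! i) # remove_nth i us) fs"
  let ?n = "length fs"
  define K where "K = {us \<in> J. length us = ?n}"
  have K: "finite K" using J by (simp add: K_def)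
  have vanish: "?s us = 0" if "length us \<noteq> ?n" for us
    using that by (auto simp: tens_length length_remove_nth intro!: sum.neutral)
  have "(\<Sum>us\<in>J. c us * ?s us) = (\<Sum>us\<in>K. c us * ?s us)"
    using J vanish by (intro sum.mono_neutral_right) (auto simp: K_def)
  also have "\<dots> = (\<Sum>us\<in>K. \<Sum>i<?n. ?k ?n i * (c us * tens (T (us ! i) # remove_nth i us) fs))"
    by (rule sum.cong) (auto simp: K_def sum_distrib_left mult_ac)
  also have "\<dots> = (\<Sum>i<?n. ?k ?n i * (\<Sum>us\<in>K. c us * tens (T (us ! i) # remove_nth i us) fs))"
    by (subst sum.swap) (simp only: sum_distrib_left)
  also have "\<dots> = 0"
  proof (intro sum.neutral ballI)
    fix i assume "i \<in> {..<?n}"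
    then obtain f fs' where fs: "fs = f # fs'" and i: "i < ?n" by (cases fs) auto
    define a where "a us = c us * tens (remove_nth i us) fs'" for us
    define z where "z = (\<Sum>us\<in>K. cscale (a us) (us ! i))"
    have inD: "us ! i \<in> D" if "us \<in> K" for us
      using that J(2) i nth_mem[of i us] by (fastforce simp: K_def)
    have "cinner g z = 0" for g
    proof -
      have "cinner g z = (\<Sum>us\<in>K. c us * tens us (take i fs' @ g # drop i fs'))"
        unfolding z_def cinner_sum_scale using i
        by (intro sum.cong) (auto simp: K_def fs a_def tens_insert)
      also have "\<dots> = (\<Sum>us\<in>J. c us * tens us (take i fs' @ g # drop i fs'))"
        using J i by (intro sum.mono_neutral_left) (auto simp: K_def fs tens_length)
      finally show ?thesis using 0 by simp
    qed
    from this[of z] have "z = 0" by (simp add: cinner_self)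
    moreover have "T z = (\<Sum>us\<in>K. cscale (a us) (T (us ! i)))"
      unfolding z_def by (rule operator_on_sum[OF T D K inD])
    moreover have "T 0 = 0"
      using operator_on_sum[OF T D finite.emptyI] by simp
    ultimately have "(\<Sum>us\<in>K. cscale (a us) (T (us ! i))) = 0" by simp
    then have "cinner f (\<Sum>us\<in>K. cscale (a us) (T (us ! i))) = 0"
      by (simp add: cinner_def zero_complex.code)
    then have "(\<Sum>us\<in>K. c us * tens (T (us ! i) # remove_nth i us) fs) = 0"
      by (simp add: cinner_sum_scale fs tens_Cons_Cons a_def mult_ac)
    then show "?k ?n i * (\<Sum>us\<in>K. c us * tens (T (us ! i) # remove_nth i us) fs) = 0" by simp
  qed
  finally show "(\<Sum>us\<in>J. c us * ?s us) = 0" .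
qed

lemma preservation_tens:
  assumes "operator_on D T" "cplx.subspace D" "us \<in> lists D"
  shows "preservation q t D T (tens us) = (\<lambda>fs. \<Sum>i<length us.
     of_real (q ^ i * t ^ (length us - 1 - i)) * tens (T (us ! i) # remove_nth i us) fs)"
  unfolding preservation_def
  by (rule lin_ext_basis[OF lin_compatible_preservation[OF assms(1,2)] assms(3)])

lemma tens_permute:
  assumes "\<sigma> permutes {..<length us}" "length fs = length us"
  shows "tens (permute_list \<sigma> us) fs = tens us (permute_list (inv \<sigma>) fs)"
proof -
  have inv: "inv \<sigma> permutes {..<length us}" by (rule permutes_inv[OF assms(1)])
  have "(\<Prod>i<length us. cinner (fs ! i) (us ! \<sigma> i)) =
      (\<Prod>i<length us. cinner (fs ! inv \<sigma> i) (us ! i))"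
    by (subst prod.permute[OF inv]) (simp add: permutes_inverses[OF assms(1)])
  then show ?thesis
    using assms inv by (simp add: tens_def permute_list_nth)
qed

lemma lin_compatible_symmetrizer: "lin_compatible tens UNIV (\<lambda>us fs. \<Sum>\<sigma> | \<sigma> permutes {..<length us}.
     of_real (q ^ inversions (length us) \<sigma> * t ^ ((length us choose 2) - inversions (length us) \<sigma>)) *
     tens (permute_list \<sigma> us) fs)"
proof (rule lin_compatibleI)
  fix J :: "'a cplx list set" and c and fs :: "'a cplx list"
  assume 0: "\<And>x. (\<Sum>i\<in>J. c i * tens i x) = 0"
  let ?k = "\<lambda>n \<sigma>. of_real (q ^ inversions n \<sigma> * t ^ ((n choose 2) - inversions n \<sigma>)) :: complex"
  let ?n = "length fs"
  have eq: "(\<Sum>\<sigma> | \<sigma> permutes {..<length us}. ?k (length us) \<sigma> * tens (permute_list \<sigma> us) fs)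
    = (\<Sum>\<sigma> | \<sigma> permutes {..<?n}. ?k ?n \<sigma> * tens us (permute_list (inv \<sigma>) fs))" for us
  proof (cases "length us = ?n")
    case True
    then show ?thesis by (intro sum.cong) (auto simp: tens_permute)
  next
    case False
    then show ?thesis by (simp add: tens_length)
  qed
  have "(\<Sum>us\<in>J. c us * (\<Sum>\<sigma> | \<sigma> permutes {..<length us}. ?k (length us) \<sigma> * tens (permute_list \<sigma> us) fs))
    = (\<Sum>us\<in>J. \<Sum>\<sigma> | \<sigma> permutes {..<?n}. ?k ?n \<sigma> * (c us * tens us (permute_list (inv \<sigma>) fs)))"
    unfolding eq sum_distrib_left by (simp add: mult_ac)
  also have "\<dots> = (\<Sum>\<sigma> | \<sigma> permutes {..<?n}. ?k ?n \<sigma> * (\<Sum>us\<in>J. c us * tens us (permute_list (inv \<sigma>) fs)))"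
    by (subst sum.swap) (simp only: sum_distrib_left)
  finally show "(\<Sum>us\<in>J. c us * (\<Sum>\<sigma> | \<sigma> permutes {..<length us}. ?k (length us) \<sigma> * tens (permute_list \<sigma> us) fs)) = 0"
    using 0 by simp
qed

lemma symmetrizer_tens: "symmetrizer q t (tens us) = (\<lambda>fs. \<Sum>\<sigma> | \<sigma> permutes {..<length us}.
     of_real (q ^ inversions (length us) \<sigma> * t ^ ((length us choose 2) - inversions (length us) \<sigma>)) *
     tens (permute_list \<sigma> us) fs)"
  unfolding symmetrizer_def by (rule lin_ext_basis[OF lin_compatible_symmetrizer]) simp

lemma lin_compatible_op_tensor:
  fixes D :: "'a::real_inner cplx set" and D' :: "'b::real_inner cplx set"
    and S :: "('a cplx list \<Rightarrow> complex) \<Rightarrow> 'a cplx list \<Rightarrow> complex"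
    and S' :: "('b cplx list \<Rightarrow> complex) \<Rightarrow> 'b cplx list \<Rightarrow> complex"
  assumes S: "lin_compatible tens (lists D) (\<lambda>us. S (tens us))"
    and S': "lin_compatible tens (lists D') (\<lambda>vs. S' (tens vs))"
  shows "lin_compatible dtens (diag_index D D') (\<lambda>(us, vs). tprod (S (tens us)) (S' (tens vs)))"
proof (rule lin_compatibleI)
  fix J :: "('a cplx list \<times> 'b cplx list) set" and c and y :: "'a cplx list \<times> 'b cplx list"
  assume J: "finite J" "J \<subseteq> diag_index D D'" and 0: "\<And>x. (\<Sum>i\<in>J. c i * dtens i x) = 0"
  obtain fs gs where y: "y = (fs, gs)" by (cases y)
  have by_fst: "(\<Sum>i\<in>J. b i * h (fst i)) = (\<Sum>us\<in>fst ` J. (\<Sum>i | i \<in> J \<and> fst i = us. b i) * h us)"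
    for b and h :: "'a cplx list \<Rightarrow> complex"
  proof -
    have "(\<Sum>i\<in>J. b i * h (fst i)) = (\<Sum>us\<in>fst ` J. \<Sum>i | i \<in> J \<and> fst i = us. b i * h (fst i))"
      by (rule sum.image_gen[OF J(1)])
    also have "\<dots> = (\<Sum>us\<in>fst ` J. (\<Sum>i | i \<in> J \<and> fst i = us. b i) * h us)"
      by (intro sum.cong) (auto simp: sum_distrib_right)
    finally show ?thesis .
  qed
  have by_snd: "(\<Sum>i\<in>J. b i * h (snd i)) = (\<Sum>vs\<in>snd ` J. (\<Sum>i | i \<in> J \<and> snd i = vs. b i) * h vs)"
    for b and h :: "'b cplx list \<Rightarrow> complex"
  proof -
    have "(\<Sum>i\<in>J. b i * h (snd i)) = (\<Sum>vs\<in>snd ` J. \<Sum>i | i \<in> J \<and> snd i = vs. b i * h (snd i))"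
      by (rule sum.image_gen[OF J(1)])
    also have "\<dots> = (\<Sum>vs\<in>snd ` J. (\<Sum>i | i \<in> J \<and> snd i = vs. b i) * h vs)"
      by (intro sum.cong) (auto simp: sum_distrib_right)
    finally show ?thesis .
  qed
  have half: "(\<Sum>i\<in>J. (c i * tens (snd i) gs') * S (tens (fst i)) fs) = 0" for gs'
    unfolding by_fst[of _ "\<lambda>us. S (tens us) fs"]
  proof (rule lin_compatibleD[OF S])
    show "fst ` J \<subseteq> lists D" "finite (fst ` J)" using J by (auto simp: diag_index_def)
    show "(\<Sum>us\<in>fst ` J. (\<Sum>i | i \<in> J \<and> fst i = us. c i * tens (snd i) gs') * tens us x) = 0" for x
      using 0[of "(x, gs')"] unfolding by_fst[symmetric]
      by (simp add: dtens_def tprod_def mult_ac)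
  qed
  have "(\<Sum>i\<in>J. (c i * S (tens (fst i)) fs) * S' (tens (snd i)) gs) = 0"
    unfolding by_snd[of _ "\<lambda>vs. S' (tens vs) gs"]
  proof (rule lin_compatibleD[OF S'])
    show "snd ` J \<subseteq> lists D'" "finite (snd ` J)" using J by (auto simp: diag_index_def)
    show "(\<Sum>vs\<in>snd ` J. (\<Sum>i | i \<in> J \<and> snd i = vs. c i * S (tens (fst i)) fs) * tens vs x) = 0" for x
      using half[of x] unfolding by_snd[symmetric] by (simp add: mult_ac)
  qed
  then show "(\<Sum>i\<in>J. c i * (case i of (us, vs) \<Rightarrow> tprod (S (tens us)) (S' (tens vs))) y) = 0"
    by (simp add: y tprod_def case_prod_unfold mult_ac)
qed

lemma lin_compatible_op_basis:
  assumes "lin_compatible tens I g" "lists D \<subseteq> I" "\<And>us. us \<in> I \<Longrightarrow> S (tens us) = g us"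
  shows "lin_compatible tens (lists D) (\<lambda>us. S (tens us))"
proof (rule lin_compatibleI)
  fix J c y assume J: "finite J" "J \<subseteq> lists D" "\<And>x. (\<Sum>i\<in>J. c i * tens i x) = 0"
  have "(\<Sum>i\<in>J. c i * S (tens i) y) = (\<Sum>i\<in>J. c i * g i y)"
  proof (rule sum.cong[OF refl])
    fix us assume "us \<in> J"
    then have "us \<in> I" using J(2) assms(2) by blast
    then show "c us * S (tens us) y = c us * g us y" by (simp only: assms(3))
  qed
  also have "\<dots> = 0" using assms J by (intro lin_compatibleD[OF assms(1)]) auto
  finally show "(\<Sum>i\<in>J. c i * S (tens i) y) = 0" .
qed

lemmas lin_compatible_operators =
  lin_compatible_op_basis[OF lin_compatible_creation subset_UNIV creation_tens]
  lin_compatible_op_basis[OF lin_compatible_annihilation subset_UNIV annihilation_tens]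
  lin_compatible_op_basis[OF lin_compatible_preservation subset_refl preservation_tens]
  lin_compatible_op_basis[OF lin_compatible_symmetrizer subset_UNIV symmetrizer_tens]

lemma op_tensor_sum:
  assumes "lin_compatible tens (lists D) (\<lambda>us. S (tens us))"
    and "lin_compatible tens (lists D') (\<lambda>vs. S' (tens vs))"
    and "finite J" "J \<subseteq> diag_index D D'"
  shows "op_tensor D D' S S' (\<lambda>x. \<Sum>i\<in>J. c i * dtens i x) =
    (\<lambda>y. \<Sum>i\<in>J. c i * tprod (S (tens (fst i))) (S' (tens (snd i))) y)"
  unfolding op_tensor_def lin_ext_sum[OF lin_compatible_op_tensor[OF assms(1,2)] assms(3,4)]
  by (simp add: case_prod_unfold)

lemma dtens_cnj: "cnj (dtens i j) = dtens j i"
  by (simp add: dtens_def tprod_def tens_def case_prod_unfold cinner_cnj)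

lemma tensor_inner_sum:
  assumes J: "finite J" "J \<subseteq> diag_index UNIV UNIV" and K: "finite K" "K \<subseteq> diag_index UNIV UNIV"
  shows "tensor_inner (\<lambda>x. \<Sum>i\<in>J. c i * dtens i x) (\<lambda>x. \<Sum>j\<in>K. d j * dtens j x) =
    (\<Sum>i\<in>J. \<Sum>j\<in>K. cnj (c i) * d j * dtens j i)"
proof -
  have right: "(\<Sum>i\<in>J. \<Sum>j\<in>K. cnj (c i) * d j * dtens j i) = (\<Sum>i\<in>J. cnj (c i) * (\<Sum>j\<in>K. d j * dtens j i))"
    for J :: "('a cplx list \<times> 'b cplx list) set" and K c d
    by (simp add: sum_distrib_left mult_ac)
  have left: "(\<Sum>i\<in>J. \<Sum>j\<in>K. cnj (c i) * d j * dtens j i) = (\<Sum>j\<in>K. d j * cnj (\<Sum>i\<in>J. c i * dtens i j))"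
    for J :: "('a cplx list \<times> 'b cplx list) set" and K c d
    by (subst sum.swap) (simp add: sum_distrib_left mult_ac dtens_cnj)
  show ?thesis
    unfolding tensor_inner_def
  proof (rule the_equality, goal_cases)
    case 1
    then show ?case using assms by blast
  next
    case (2 z)
    then obtain J' c' K' d' where eq:
      "(\<lambda>x. \<Sum>i\<in>J. c i * dtens i x) = (\<lambda>x. \<Sum>i\<in>J'. c' i * dtens i x)"
      "(\<lambda>x. \<Sum>j\<in>K. d j * dtens j x) = (\<lambda>x. \<Sum>j\<in>K'. d' j * dtens j x)"
      "z = (\<Sum>i\<in>J'. \<Sum>j\<in>K'. cnj (c' i) * d' j * dtens j i)"
      by blast
    have "z = (\<Sum>i\<in>J'. \<Sum>j\<in>K. cnj (c' i) * d j * dtens j i)"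
      unfolding eq(3) right using fun_cong[OF eq(2)] by simp
    also have "\<dots> = (\<Sum>i\<in>J. \<Sum>j\<in>K. cnj (c i) * d j * dtens j i)"
      unfolding left using fun_cong[OF eq(1)] by simp
    finally show ?case .
  qed
qed

end

theory Submission
  imports Defs
begin

text \<open>
  The product \<open>X\<^sub>1 \<cdots> X\<^sub>n\<close> is applied to the vacuum one factor at a time, so the points are met in the
  order \<open>n, n - 1, \<dots>, 1\<close>.  Expanding every factor into its four summands turns the intermediate
  vector into a sum over unfinished partitions of the points met so far.  Creation at \<open>k\<close> opens the
  new block \<open>{k}\<close>, the scalar adds the finished block \<open>{k}\<close>, preservation at \<open>k\<close> adds \<open>k\<close> to an open
  block and leaves it open, and annihilation at \<open>k\<close> adds \<open>k\<close> to an open block and finishes it.  The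
  tensor carries one factor for each open block, namely the vector
  \<open>T\<^sub>i\<^sub>1 \<cdots> T\<^sub>i\<^sub>m\<^sub>-\<^sub>1 \<xi>\<^sub>i\<^sub>m\<close> of that block, and the factors are ordered by the least elements of
  the blocks, since creation and preservation both put the block of the newest point in front.  Every
  finished partition arises exactly once (\<open>configs_isolated\<close>, \<open>configs_create\<close>,
  \<open>configs_annihilate\<close>, \<open>configs_preserve\<close>).

  The powers of \<open>q\<close> and \<open>t\<close> count crossings and nestings.  An open block with least element \<open>m\<close> will be
  extended to the left, so it is given a half arc that ends at \<open>m\<close> and starts to the left of all
  points.  If \<open>k\<close> is attached to the open block at position \<open>i\<close> of \<open>N\<close>, then its half arc becomes the
  arc \<open>(k, m)\<close>.  The \<open>i\<close> half arcs that end between \<open>k\<close> and \<open>m\<close> cross this arc, the \<open>N - 1 - i\<close> half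
  arcs that end after \<open>m\<close> nest it, and no other relation between two arcs changes
  (\<open>attach_half_arc\<close>).  This matches the coefficient \<open>q\<^sup>i t\<^sup>N\<^sup>-\<^sup>1\<^sup>-\<^sup>i\<close> of the operators.

  On the diagonal Fock space both tensor factors use the same of the four summands at each point and
  choose their positions independently.  The summands are recorded by two sets: \<open>L\<close>, the
  points at which an arc starts (annihilation, preservation), and \<open>R\<close>, the points at which an arc ends
  (creation, preservation).  Hence the vector is a sum over \<open>(L, R)\<close> of tensor products of two
  one-sided sums (\<open>field_op_state\<close>).  The vacuum component keeps the terms without open blocks, that
  is, pairs of partitions with common \<open>L\<close> and \<open>R\<close>.  Since \<open>L - R\<close>, \<open>L \<inter> R\<close> and the complement of
  \<open>L \<union> R\<close> are the openers, the middle points and the singletons, these pairs are the diagonal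
  partitions (\<open>sum_diag_partitions\<close>), and matching blocks by their least elements identifies the
  weights (\<open>prod_matched_blocks\<close>).
\<close>

section \<open>Configurations: partitions with open blocks\<close>

definition min_sorted :: "nat set list \<Rightarrow> bool" where
  "min_sorted us \<longleftrightarrow> sorted_wrt (\<lambda>B B'. Min B < Min B') us"

text \<open>
  \<open>L\<close> is the set of points at which an arc starts and \<open>R\<close> the set of points at which an arc ends:
  in a finished block an arc starts at every element but the largest and ends at every element but
  the smallest.  In an open block the smallest element is already the end of an arc, whose start
  is yet to come.
\<close>

definition closed_block :: "nat set \<Rightarrow> nat set \<Rightarrow> nat set \<Rightarrow> bool" where
  "closed_block L R B \<longleftrightarrow> B \<inter> L = B - {Max B} \<and> B \<inter> R = B - {Min B}"

definition open_block :: "nat set \<Rightarrow> nat set \<Rightarrow> nat set \<Rightarrow> bool" where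
  "open_block L R B \<longleftrightarrow> B \<inter> L = B - {Max B} \<and> B \<subseteq> R"

text \<open>
  A configuration \<open>(C, us)\<close> is a partition into finished blocks \<open>C\<close> and open blocks \<open>us\<close>.  The open
  blocks form a list because their order is the order of the tensor factors.
\<close>

type_synonym config = "nat set set \<times> nat set list"

definition configs :: "nat set \<Rightarrow> nat set \<Rightarrow> nat set \<Rightarrow> config set" where
  "configs L R A = {(C, us). partition_on A (C \<union> set us) \<and> C \<inter> set us = {} \<and> min_sorted us \<and>
     (\<forall>B\<in>C. closed_block L R B) \<and> (\<forall>B\<in>set us. open_block L R B)}"

lemma configsD:
  assumes "(C, us) \<in> configs L R A"
  shows "partition_on A (C \<union> set us)" "C \<inter> set us = {}" "min_sorted us"
    "\<And>B. B \<in> C \<Longrightarrow> closed_block L R B" "\<And>B. B \<in> set us \<Longrightarrow> open_block L R B"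
    "\<And>B. B \<in> C \<Longrightarrow> B \<subseteq> A" "\<And>B. B \<in> set us \<Longrightarrow> B \<subseteq> A"
    "{} \<notin> C" "{} \<notin> set us"
  using assms by (auto simp: configs_def partition_on_def)

lemma min_sorted_distinct: "min_sorted us \<Longrightarrow> distinct us"
  unfolding min_sorted_def by (induction us) auto

lemma min_sorted_unique:
  assumes "min_sorted us" "min_sorted vs" "set us = set vs"
  shows "us = vs"
proof -
  have *: "sorted_wrt (<) (map Min us)" "sorted_wrt (<) (map Min vs)"
    using assms(1,2) by (simp_all add: min_sorted_def sorted_wrt_map)
  then have "distinct (map Min us)" by (simp add: strict_sorted_iff)
  then have inj: "inj_on Min (set us)" by (simp add: distinct_map)
  have "map Min us = map Min vs"
    by (rule strict_sorted_equal) (use * assms(3) in auto)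
  then show ?thesis using inj assms(3) by (simp add: inj_on_map_eq_map)
qed

lemma min_sorted_remove_nth:
  assumes "min_sorted us" "i < length us"
  shows "min_sorted (remove_nth i us)" "us ! i \<notin> set (remove_nth i us)"
    "set us = insert (us ! i) (set (remove_nth i us))"
proof -
  have us: "us = take i us @ us ! i # drop (Suc i) us" using assms(2) by (rule id_take_nth_drop)
  have "min_sorted (take i us @ us ! i # drop (Suc i) us)" using us assms(1) by simp
  then show "min_sorted (remove_nth i us)" "us ! i \<notin> set (remove_nth i us)"
    by (auto simp: min_sorted_def remove_nth_def sorted_wrt_append)
  show "set us = insert (us ! i) (set (remove_nth i us))"
    by (subst us) (simp add: remove_nth_def)
qed

text \<open>
  Undoes \<^const>\<open>remove_nth\<close>: the position at which a block was removed can be recovered from the minima.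
  This makes attaching a point to an open block invertible.
\<close>

lemma min_sorted_insert:
  assumes "min_sorted vs" "\<And>B'. B' \<in> set vs \<Longrightarrow> Min B' \<noteq> Min B"
  obtains us i where "min_sorted us" "i < length us" "us ! i = B" "remove_nth i us = vs"
proof -
  \<comment> \<open>\<open>B\<close> is put in front of the first block with a larger minimum.\<close>
  define P where "P = (\<lambda>B'. Min B' < Min B)"
  define us where "us = takeWhile P vs @ B # dropWhile P vs"
  define i where "i = length (takeWhile P vs)"
  have "Min B < Min B'" if "B' \<in> set (dropWhile P vs)" for B'
  proof -
    have "dropWhile P vs \<noteq> []" using that by force
    then obtain x xs where *: "dropWhile P vs = x # xs" by (meson neq_Nil_conv)
    then have "\<not> P x" by (simp add: dropWhile_eq_Cons_conv)
    moreover have "x \<in> set vs" using * by (metis list.set_intros(1) set_dropWhileD)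
    ultimately have x: "Min B < Min x" using assms(2)[of x] by (auto simp: P_def)
    have "sorted_wrt (\<lambda>B B'. Min B < Min B') (takeWhile P vs @ x # xs)"
      using assms(1) * by (metis min_sorted_def takeWhile_dropWhile_id)
    then show ?thesis using x that * by (auto simp: sorted_wrt_append intro: less_trans)
  qed
  moreover have "sorted_wrt (\<lambda>B B'. Min B < Min B') (takeWhile P vs)" "sorted_wrt (\<lambda>B B'. Min B < Min B') (dropWhile P vs)"
    using assms(1) by (metis min_sorted_def sorted_wrt_append takeWhile_dropWhile_id)+
  moreover have "Min B' < Min B" if "B' \<in> set (takeWhile P vs)" for B'
    using set_takeWhileD[OF that] by (simp add: P_def)
  ultimately have "min_sorted us"
    by (auto simp: min_sorted_def us_def sorted_wrt_append intro: less_trans)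
  moreover have "i < length us" "us ! i = B" "remove_nth i us = vs"
    by (simp_all add: us_def i_def nth_append remove_nth_def)
  ultimately show ?thesis using that by blast
qed

text \<open>
  Attaching a smaller point \<open>k\<close> to an open block uses up its pending arc end; the result is finished
  or open according to whether a further arc is to end at \<open>k\<close>.
\<close>

lemma extend_block_kind:
  assumes "finite B" "B \<noteq> {}" "\<And>x. x \<in> B \<Longrightarrow> k < x" "k \<notin> L" "k \<notin> R"
  shows "closed_block (insert k L) R (insert k B) \<longleftrightarrow> open_block L R B"
    and "open_block (insert k L) (insert k R) (insert k B) \<longleftrightarrow> open_block L R B"
proof -
  have "Max B \<in> B" using assms(1,2) by (rule Max_in)
  then have "k < Max B" by (rule assms(3))
  then have max: "Max (insert k B) = Max B" "Max B \<noteq> k" using assms(1,2) by (simp_all add: max_def)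
  have k: "k \<notin> B" using assms(3) by blast
  have min: "Min (insert k B) = k"
    using assms(1,3) by (intro Min_eqI) (auto intro: less_imp_le)
  have "insert k B \<inter> insert k L = insert k (B \<inter> L)" "insert k B - {Max B} = insert k (B - {Max B})"
    using max(2) by auto
  then have 1: "insert k B \<inter> insert k L = insert k B - {Max B} \<longleftrightarrow> B \<inter> L = B - {Max B}"
    using k by (simp add: insert_ident)
  have 2: "insert k B \<inter> R = insert k B - {k} \<longleftrightarrow> B \<subseteq> R" "insert k B \<subseteq> insert k R \<longleftrightarrow> B \<subseteq> R"
    using k assms(5) by auto
  show "closed_block (insert k L) R (insert k B) \<longleftrightarrow> open_block L R B"
    and "open_block (insert k L) (insert k R) (insert k B) \<longleftrightarrow> open_block L R B"
    unfolding closed_block_def open_block_def max(1) min 1 2 by (rule refl)+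
qed

lemma block_kind_away:
  assumes "k \<notin> B"
  shows "closed_block (insert k L) R B = closed_block L R B" "closed_block L (insert k R) B = closed_block L R B"
    "open_block (insert k L) R B = open_block L R B" "open_block L (insert k R) B = open_block L R B"
  using assms by (auto simp: closed_block_def open_block_def)

text \<open>
  The points are met from the largest to the smallest, so a new point lies below all earlier ones.
\<close>

locale new_point =
  fixes k :: nat and A L R :: "nat set"
  assumes finite_A: "finite A" and less_A: "\<And>x. x \<in> A \<Longrightarrow> k < x" and LR: "L \<subseteq> A" "R \<subseteq> A"
begin

lemma not_in: "k \<notin> A" "k \<notin> L" "k \<notin> R"
  using less_A LR by auto

lemma config_not_in:
  assumes "(C, us) \<in> configs L R A"
  shows "B \<in> C \<Longrightarrow> k \<notin> B" "B \<in> set us \<Longrightarrow> k \<notin> B" "insert k X \<notin> C" "insert k X \<notin> set us"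
  using configsD(6,7)[OF assms] not_in by blast+

lemma min_new: "B \<subseteq> insert k A \<Longrightarrow> k \<in> B \<Longrightarrow> Min B = k"
  by (rule Min_eqI) (use finite_A less_A in \<open>auto intro: finite_subset less_imp_le\<close>)

lemma Min_gt: "B \<subseteq> A \<Longrightarrow> B \<noteq> {} \<Longrightarrow> k < Min B"
  using finite_A less_A by (meson Min_in finite_subset subsetD)

lemma partition_insert_new:
  assumes "\<And>B. B \<in> P \<Longrightarrow> k \<notin> B" "B \<notin> P" "k \<notin> B" "B \<noteq> {}"
  shows "partition_on (insert k A) (insert (insert k B) P) \<longleftrightarrow> partition_on A (insert B P)"
proof -
  have eq: "insert k A - insert k B = A - B" using not_in by auto
  show ?thesis
  proof
    assume l: "partition_on (insert k A) (insert (insert k B) P)"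
    then have "disjnt (insert k B) (\<Union>P)"
      using assms(1) by (auto simp: partition_on_def pairwise_insert disjnt_iff)
    with l show "partition_on A (insert B P)"
      using partition_on_insert[of "insert k B" P "insert k A"] partition_on_insert[of B P A] eq assms(3,4)
      by (auto simp: disjnt_iff)
  next
    assume r: "partition_on A (insert B P)"
    then have "disjnt B (\<Union>P)"
      using assms(2) by (auto simp: partition_on_def pairwise_insert disjnt_iff)
    moreover from this have "disjnt (insert k B) (\<Union>P)" using assms(1) by (auto simp: disjnt_iff)
    ultimately show "partition_on (insert k A) (insert (insert k B) P)"
      using r partition_on_insert[of "insert k B" P] partition_on_insert[of B P] eq
      by auto
  qed
qed

lemma partition_insert_single:
  assumes "\<And>B. B \<in> P \<Longrightarrow> k \<notin> B"
  shows "partition_on (insert k A) (insert {k} P) \<longleftrightarrow> partition_on A P"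
  using partition_on_insert[of "{k}" P "insert k A"] assms not_in by (auto simp: disjnt_iff)

end

section \<open>Adding a point below all others\<close>

lemma configs_empty: "configs L R {} = {({}, [])}"
  by (auto simp: configs_def partition_on_empty min_sorted_def)

lemma finite_configs:
  assumes "finite A"
  shows "finite (configs L R A)"
proof (rule finite_subset)
  show "configs L R A \<subseteq> Pow (Pow A) \<times> {us. set us \<subseteq> Pow A \<and> distinct us}"
    by (auto simp: configs_def partition_on_def min_sorted_distinct)
  show "finite (Pow (Pow A) \<times> {us. set us \<subseteq> Pow A \<and> distinct us})"
    using assms by (intro finite_cartesian_product finite_subset_distinct) auto
qed

context new_point
begin

lemma open_block_split:
  assumes "(C, us) \<in> configs L R A" "i < length us"
  shows "insert (us ! i) (C \<union> set (remove_nth i us)) = C \<union> set us"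
    "us ! i \<notin> C \<union> set (remove_nth i us)" "k \<notin> us ! i" "us ! i \<noteq> {}" "finite (us ! i)"
    "\<And>x. x \<in> us ! i \<Longrightarrow> k < x"
proof -
  note c = configsD[OF assms(1)]
  have B: "us ! i \<in> set us" using assms(2) by simp
  show "insert (us ! i) (C \<union> set (remove_nth i us)) = C \<union> set us"
    "us ! i \<notin> C \<union> set (remove_nth i us)"
    using min_sorted_remove_nth[OF c(3) assms(2)] c(2) B by auto
  have sub: "us ! i \<subseteq> A" using B by (rule c(7))
  show "us ! i \<noteq> {}" using B c(9) by metis
  show "k \<notin> us ! i" using sub not_in by blast
  show "finite (us ! i)" using sub finite_A by (rule finite_subset)
  show "\<And>x. x \<in> us ! i \<Longrightarrow> k < x" using sub less_A by blast
qed

lemma min_sorted_Cons_new: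
  assumes "\<And>B. B \<in> set us \<Longrightarrow> B \<subseteq> A" "{} \<notin> set us" "Min X = k"
  shows "min_sorted (X # us) \<longleftrightarrow> min_sorted us"
proof -
  have "k < Min B" if "B \<in> set us" for B
    using that assms by (intro Min_gt) auto
  then show ?thesis using assms(3) by (auto simp: min_sorted_def)
qed

text \<open>
  The block of the new point \<open>k\<close> reveals the step that produced it: \<open>k \<in> L'\<close> tells whether \<open>k\<close> was
  attached to an earlier block, and \<open>k \<in> R'\<close> whether that block is still open.
\<close>

lemma config_block_new:
  assumes c: "(C', us') \<in> configs L' R' (insert k A)" and B: "B \<in> C' \<union> set us'" "k \<in> B"
  shows "Min B = k" "finite B" "\<And>x. x \<in> B - {k} \<Longrightarrow> k < x" "\<And>B'. B' \<in> C' \<union> set us' - {B} \<Longrightarrow> B' \<subseteq> A"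
    "k \<in> L' \<longleftrightarrow> B \<noteq> {k}" "B \<in> C' \<Longrightarrow> k \<notin> R'" "B \<in> set us' \<Longrightarrow> k \<in> R'"
proof -
  note d = configsD[OF c]
  have sub: "B \<subseteq> insert k A" using B d(6,7) by auto
  then show fin: "finite B" using finite_A by (auto intro: finite_subset)
  show mn: "Min B = k" using sub B(2) by (rule min_new)
  show "k < x" if "x \<in> B - {k}" for x using that sub less_A by auto
  show "B' \<subseteq> A" if "B' \<in> C' \<union> set us' - {B}" for B'
  proof -
    have "B' \<inter> B = {}" using that d(1) B(1) by (intro disjointD[of "C' \<union> set us'"]) (auto simp: partition_on_def)
    moreover have "B' \<subseteq> insert k A" using that d(6,7) by auto
    ultimately show ?thesis using B(2) by blast
  qed
  have "B \<inter> L' = B - {Max B}"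
    using B d(4,5) by (auto simp: closed_block_def open_block_def)
  moreover have "Max B = k \<longleftrightarrow> B = {k}"
  proof
    assume "Max B = k"
    then show "B = {k}" using fin B(2) mn Max_ge[OF fin] Min_le[OF fin] by (metis antisym insertI1 subsetI subset_singleton_iff singletonI empty_iff)
  qed simp
  ultimately show "k \<in> L' \<longleftrightarrow> B \<noteq> {k}" using B(2) by auto
  show "B \<in> C' \<Longrightarrow> k \<notin> R'" using d(4) mn B(2) by (auto simp: closed_block_def)
  show "B \<in> set us' \<Longrightarrow> k \<in> R'" using d(5) B(2) by (auto simp: open_block_def)
qed

lemma config_block_exists:
  assumes c: "(C', us') \<in> configs L' R' (insert k A)"
  obtains B where "B \<in> C' \<union> set us'" "k \<in> B"
  using configsD(1)[OF c] by (auto simp: partition_on_def)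

text \<open>
  An open block that contains \<open>k\<close> has the least minimum, hence it is the first in the list.
\<close>

lemma open_head_new:
  assumes c: "(C', us') \<in> configs L' R' (insert k A)" and B: "B \<in> set us'" "k \<in> B"
  obtains vs where "us' = B # vs" "set vs = set us' - {B}" "min_sorted vs"
proof -
  note d = configsD[OF c]
  have gt: "k < Min B'" if "B' \<in> set us' - {B}" for B'
    using that d(9) config_block_new(4)[OF c _ B(2), of B'] B(1) by (intro Min_gt) auto
  have mn: "Min B = k" using config_block_new(1)[OF c] B by blast
  obtain X vs where us': "us' = X # vs" using B(1) by (cases us') auto
  have "X = B"
  proof (rule ccontr)
    assume "X \<noteq> B"
    then have "Min X < Min B" using d(3) B(1) us' by (auto simp: min_sorted_def)
    moreover have "k < Min X" using gt \<open>X \<noteq> B\<close> us' by simp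
    ultimately show False using mn by simp
  qed
  then show ?thesis using that us' d(3) min_sorted_distinct[OF d(3)] by (auto simp: min_sorted_def)
qed

text \<open>
  The scalar term: \<open>k\<close> becomes a finished singleton.
\<close>

lemma configs_isolated:
  "configs L R (insert k A) = (\<lambda>(C, us). (insert {k} C, us)) ` configs L R A" (is "_ = ?f ` _")
proof (intro equalityI subsetI)
  fix s assume "s \<in> ?f ` configs L R A"
  then obtain C us where s: "s = (insert {k} C, us)" and c: "(C, us) \<in> configs L R A" by auto
  note d = configsD[OF c] and n = config_not_in[OF c]
  have "partition_on (insert k A) (insert {k} (C \<union> set us))"
    using partition_insert_single[of "C \<union> set us"] n(1,2) d(1) by blast
  moreover have "closed_block L R {k}" using not_in by (auto simp: closed_block_def)
  ultimately show "s \<in> configs L R (insert k A)"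
    using d(2-5) n by (auto simp: s configs_def)
next
  fix s assume "s \<in> configs L R (insert k A)"
  then obtain C' us' where s: "s = (C', us')" and c: "(C', us') \<in> configs L R (insert k A)" by (cases s) auto
  note d = configsD[OF c]
  obtain B where B: "B \<in> C' \<union> set us'" "k \<in> B" using config_block_exists[OF c] .
  note b = config_block_new[OF c B]
  have "B = {k}" "B \<in> C'" using b(5,7) B not_in by auto
  then have C': "C' = insert {k} (C' - {{k}})" "{k} \<in> C'" by auto
  have P: "C' \<union> set us' = insert {k} (C' - {{k}} \<union> set us')" using C' by auto
  have nk: "k \<notin> X" if "X \<in> C' - {{k}} \<union> set us'" for X
    using b(4)[of X] that not_in \<open>B = {k}\<close> d(2) C'(2) by auto
  have "partition_on A (C' - {{k}} \<union> set us')"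
    using d(1) partition_insert_single[of "C' - {{k}} \<union> set us'"] nk unfolding P by blast
  then have "(C' - {{k}}, us') \<in> configs L R A"
    using d(2-5) by (auto simp: configs_def)
  then show "s \<in> ?f ` configs L R A" using C'(1) s by (auto intro!: image_eqI)
qed

text \<open>
  The creation operator: \<open>k\<close> opens a new block.
\<close>

lemma configs_create:
  "configs L (insert k R) (insert k A) = (\<lambda>(C, us). (C, {k} # us)) ` configs L R A" (is "_ = ?f ` _")
proof (intro equalityI subsetI)
  fix s assume "s \<in> ?f ` configs L R A"
  then obtain C us where s: "s = (C, {k} # us)" and c: "(C, us) \<in> configs L R A" by auto
  note d = configsD[OF c] and n = config_not_in[OF c]
  have "partition_on (insert k A) (insert {k} (C \<union> set us))"
    using partition_insert_single[of "C \<union> set us"] n(1,2) d(1) by blast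
  moreover have "open_block L (insert k R) {k}" using not_in by (auto simp: open_block_def)
  moreover have "min_sorted ({k} # us)" using d min_sorted_Cons_new[of us "{k}"] by auto
  ultimately show "s \<in> configs L (insert k R) (insert k A)"
    using d(2-5) n by (auto simp: s configs_def block_kind_away)
next
  fix s assume "s \<in> configs L (insert k R) (insert k A)"
  then obtain C' us' where s: "s = (C', us')" and c: "(C', us') \<in> configs L (insert k R) (insert k A)"
    by (cases s) auto
  note d = configsD[OF c]
  obtain B where B: "B \<in> C' \<union> set us'" "k \<in> B" using config_block_exists[OF c] .
  note b = config_block_new[OF c B]
  have "B = {k}" "B \<in> set us'" using b(5,6) B not_in by auto
  then obtain vs where us': "us' = {k} # vs" and vs: "set vs = set us' - {{k}}" "min_sorted vs"
    using open_head_new[OF c] by blast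
  have nk: "k \<notin> X" if "X \<in> C' \<union> set vs" for X
  proof -
    have "X \<in> C' \<union> set us' - {B}" using that vs \<open>B = {k}\<close> \<open>B \<in> set us'\<close> d(2) by blast
    then show ?thesis using b(4) not_in(1) by blast
  qed
  have "partition_on A (C' \<union> set vs)"
    using d(1) partition_insert_single[of "C' \<union> set vs"] nk unfolding us' by fastforce
  moreover have "\<forall>X\<in>C'. closed_block L R X" "\<forall>X\<in>set vs. open_block L R X"
    using d(4,5) nk vs(1) by (metis DiffD1 UnCI block_kind_away(2,4))+
  moreover have "C' \<inter> set vs = {}" using d(2) vs(1) by blast
  ultimately have "(C', vs) \<in> configs L R A"
    using vs(2) by (simp add: configs_def)
  then show "s \<in> ?f ` configs L R A" using s us' by (auto intro!: image_eqI)
qed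

lemma partition_extend:
  assumes "(C, us) \<in> configs L R A" "i < length us"
  shows "partition_on (insert k A) (insert (insert k (us ! i)) (C \<union> set (remove_nth i us)))"
proof -
  note sp = open_block_split[OF assms]
  have "k \<notin> X" if "X \<in> C \<union> set (remove_nth i us)" for X
    using that sp(1) config_not_in(1,2)[OF assms(1)] by blast
  from partition_insert_new[OF this sp(2-4)] show ?thesis
    using configsD(1)[OF assms(1)] by (simp only: sp(1))
qed

text \<open>
  The inverse of attaching \<open>k\<close> to an open block: \<open>k\<close> is removed from its block, and what remains
  returns to the list of open blocks at the position determined by its minimum.
\<close>

lemma shrink_block:
  assumes part: "partition_on (insert k A) (insert B (C \<union> set vs))" and B: "k \<in> B" "B \<noteq> {k}" "B \<notin> C \<union> set vs"
    and ob: "open_block L R (B - {k})" and cl: "\<forall>X\<in>C. closed_block L R X"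
    and op: "\<forall>X\<in>set vs. open_block L R X" and vs: "min_sorted vs" "C \<inter> set vs = {}"
  obtains us i where "(C, us) \<in> configs L R A" "i < length us" "us ! i = B - {k}" "remove_nth i us = vs"
proof -
  have nk: "k \<notin> X" "X \<inter> B = {}" "X \<noteq> {}" if "X \<in> C \<union> set vs" for X
    using part that B(1,3) by (auto simp: partition_on_def disjoint_def)
  have new: "B - {k} \<notin> C \<union> set vs" using nk(2) B(1,2) by fastforce
  have B': "insert k (B - {k}) = B" "B - {k} \<noteq> {}" using B(1,2) by auto
  have partA: "partition_on A (insert (B - {k}) (C \<union> set vs))"
  proof -
    have "partition_on (insert k A) (insert (insert k (B - {k})) (C \<union> set vs)) \<longleftrightarrow>
        partition_on A (insert (B - {k}) (C \<union> set vs))"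
    proof (rule partition_insert_new)
      show "k \<notin> B - {k}" by simp
    qed (fact nk(1) new B'(2))+
    then show ?thesis using part unfolding B'(1) ..
  qed
  have fin: "finite X" if "X \<in> insert (B - {k}) (C \<union> set vs)" for X
    using partition_onD1[OF partA] that finite_A by (metis Sup_upper finite_subset)
  have "Min X \<noteq> Min (B - {k})" if "X \<in> set vs" for X
  proof
    assume eq: "Min X = Min (B - {k})"
    have "Min X \<in> X" by (rule Min_in[OF fin nk(3)]) (use that in simp_all)
    moreover have "Min (B - {k}) \<in> B - {k}" by (rule Min_in[OF fin B'(2)]) simp
    ultimately show False using nk(2)[of X] that eq by (metis DiffD1 IntI UnI2 empty_iff)
  qed
  from min_sorted_insert[OF vs(1) this] obtain us i
    where us: "min_sorted us" "i < length us" "us ! i = B - {k}" "remove_nth i us = vs" by blast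
  have set_us: "set us = insert (B - {k}) (set vs)"
    using min_sorted_remove_nth(3)[OF us(1,2)] us by simp
  have "(C, us) \<in> configs L R A"
    using partA ob cl op vs(2) new us(1) by (simp add: configs_def set_us)
  then show ?thesis using that us by blast
qed

text \<open>
  The annihilation operator: \<open>k\<close> is attached to an open block, which is then finished.
\<close>

lemma configs_annihilate:
  "configs (insert k L) R (insert k A) =
    (\<lambda>((C, us), i). (insert (insert k (us ! i)) C, remove_nth i us)) `
      (SIGMA s:configs L R A. {..<length (snd s)})" (is "_ = ?f ` ?S")
proof (intro equalityI subsetI)
  fix s assume "s \<in> ?f ` ?S"
  then obtain C us i where s: "s = (insert (insert k (us ! i)) C, remove_nth i us)"
    and c: "(C, us) \<in> configs L R A" and i: "i < length us" by auto
  note d = configsD[OF c] and n = config_not_in[OF c] and sp = open_block_split[OF c i]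
    and r = min_sorted_remove_nth[OF d(3) i]
  have "closed_block (insert k L) R (insert k (us ! i))"
    using extend_block_kind(1)[of "us ! i" k L R] sp(3-6) not_in d(5) i by auto
  moreover have "C \<inter> set (remove_nth i us) = {}" "insert k (us ! i) \<notin> set (remove_nth i us)"
    using r(3) d(2) n(4) by auto
  ultimately show "s \<in> configs (insert k L) R (insert k A)"
    using partition_extend[OF c i] r d(4,5) n(1,2) by (auto simp: s configs_def block_kind_away)
next
  fix s assume "s \<in> configs (insert k L) R (insert k A)"
  then obtain C' us' where s: "s = (C', us')" and c: "(C', us') \<in> configs (insert k L) R (insert k A)"
    by (cases s) auto
  note d = configsD[OF c]
  obtain B where B: "B \<in> C' \<union> set us'" "k \<in> B" using config_block_exists[OF c] .
  note b = config_block_new[OF c B]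
  have B': "B \<noteq> {k}" "B \<in> C'" using b(5,7) B not_in by auto
  have P: "C' \<union> set us' = insert B (C' - {B} \<union> set us')" using B'(2) by auto
  have nk: "k \<notin> X" if "X \<in> C' - {B} \<union> set us'" for X
    using b(4)[of X] that not_in B'(2) d(2) by auto
  have ob: "open_block L R (B - {k})"
    using extend_block_kind(1)[of "B - {k}" k L R] b(2,3) B(2) B' not_in d(4) by (auto simp: insert_absorb)
  have cl: "\<forall>X\<in>C' - {B}. closed_block L R X"
    using d(4) nk by (metis DiffD1 UnCI block_kind_away(1))
  have op: "\<forall>X\<in>set us'. open_block L R X"
    using d(5) nk by (auto simp: block_kind_away)
  have part: "partition_on (insert k A) (insert B (C' - {B} \<union> set us'))" using d(1) unfolding P .
  have new: "B \<notin> C' - {B} \<union> set us'" and dj: "(C' - {B}) \<inter> set us' = {}" using B'(2) d(2) by blast+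
  obtain us i where "(C' - {B}, us) \<in> configs L R A" "i < length us" "us ! i = B - {k}" "remove_nth i us = us'"
    by (rule shrink_block[OF part B(2) B'(1) new ob cl op d(3) dj])
  moreover have "insert k (B - {k}) = B" "insert B (C' - {B}) = C'" using B B'(2) by blast+
  ultimately have "s = ?f ((C' - {B}, us), i)" "((C' - {B}, us), i) \<in> ?S" by (simp_all add: s)
  then show "s \<in> ?f ` ?S" by (rule image_eqI)
qed

text \<open>
  The preservation operator: \<open>k\<close> is attached to an open block, which stays open and moves to the
  front of the list.
\<close>

lemma configs_preserve:
  "configs (insert k L) (insert k R) (insert k A) =
    (\<lambda>((C, us), i). (C, insert k (us ! i) # remove_nth i us)) `
      (SIGMA s:configs L R A. {..<length (snd s)})" (is "_ = ?f ` ?S")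
proof (intro equalityI subsetI)
  fix s assume "s \<in> ?f ` ?S"
  then obtain C us i where s: "s = (C, insert k (us ! i) # remove_nth i us)"
    and c: "(C, us) \<in> configs L R A" and i: "i < length us" by auto
  note d = configsD[OF c] and n = config_not_in[OF c] and sp = open_block_split[OF c i]
    and r = min_sorted_remove_nth[OF d(3) i]
  have "open_block (insert k L) (insert k R) (insert k (us ! i))"
    using extend_block_kind(2)[of "us ! i" k L R] sp(3-6) not_in d(5) i by auto
  moreover have "C \<inter> set (remove_nth i us) = {}" using r(3) d(2) by auto
  moreover have "Min (insert k (us ! i)) = k" using d(7)[of "us ! i"] i by (intro min_new) auto
  then have "min_sorted (insert k (us ! i) # remove_nth i us)"
    using min_sorted_Cons_new[of "remove_nth i us"] r(1,3) d(7,9) by auto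
  ultimately show "s \<in> configs (insert k L) (insert k R) (insert k A)"
    using partition_extend[OF c i] r d(4,5) n by (auto simp: s configs_def block_kind_away)
next
  fix s assume "s \<in> configs (insert k L) (insert k R) (insert k A)"
  then obtain C' us' where s: "s = (C', us')"
    and c: "(C', us') \<in> configs (insert k L) (insert k R) (insert k A)"
    by (cases s) auto
  note d = configsD[OF c]
  obtain B where B: "B \<in> C' \<union> set us'" "k \<in> B" using config_block_exists[OF c] .
  note b = config_block_new[OF c B]
  have B': "B \<noteq> {k}" "B \<in> set us'" using b(5,6) B not_in by auto
  then obtain vs where us': "us' = B # vs" and vs: "set vs = set us' - {B}" "min_sorted vs"
    using open_head_new[OF c _ B(2)] by blast
  have P: "C' \<union> set us' = insert B (C' \<union> set vs)" using us' by auto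
  have nk: "k \<notin> X" "X \<noteq> B" if "X \<in> C' \<union> set vs" for X
    using b(4)[of X] that not_in B'(2) d(2) vs B by auto
  have ob: "open_block L R (B - {k})"
    using extend_block_kind(2)[of "B - {k}" k L R] b(2,3) B(2) B' not_in d(5) by (auto simp: insert_absorb)
  have cl: "\<forall>X\<in>C'. closed_block L R X"
    using d(4) nk(1) by (metis UnCI block_kind_away(1,2))
  have op: "\<forall>X\<in>set vs. open_block L R X"
    using d(5) nk(1) vs(1) by (metis DiffD1 UnCI block_kind_away(3,4))
  have part: "partition_on (insert k A) (insert B (C' \<union> set vs))" using d(1) unfolding P .
  have new: "B \<notin> C' \<union> set vs" and dj: "C' \<inter> set vs = {}" using nk(2) d(2) vs(1) by blast+
  obtain us i where "(C', us) \<in> configs L R A" "i < length us" "us ! i = B - {k}" "remove_nth i us = vs"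
    by (rule shrink_block[OF part B(2) B'(1) new ob cl op vs(2) dj])
  moreover have "insert k (B - {k}) = B" using B by blast
  ultimately have "s = ?f ((C', us), i)" "((C', us), i) \<in> ?S" by (simp_all add: s us')
  then show "s \<in> ?f ` ?S" by (rule image_eqI)
qed

text \<open>
  The block and the position to which \<open>k\<close> was attached can be read off from the result, so distinct
  choices give distinct configurations.
\<close>

lemma extension_determines:
  assumes c: "(C, us) \<in> configs L R A" "i < length us" and c': "(C', us') \<in> configs L R A" "i' < length us'"
    and eq: "insert k (us ! i) = insert k (us' ! i')" "remove_nth i us = remove_nth i' us'"
  shows "us = us'" "i = i'"
proof -
  have B: "us ! i = us' ! i'"
    using eq(1) open_block_split(3)[OF c] open_block_split(3)[OF c'] by (simp add: insert_ident)
  have s: "min_sorted us" "min_sorted us'" using c(1) c'(1) by (auto simp: configs_def)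
  show "us = us'"
    using s min_sorted_remove_nth(3)[OF s(1) c(2)] min_sorted_remove_nth(3)[OF s(2) c'(2)] B eq(2)
    by (intro min_sorted_unique) auto
  then show "i = i'" using B c(2) c'(2) min_sorted_distinct[OF s(1)] by (simp add: nth_eq_iff_index_eq)
qed

lemma inj_isolated: "inj_on (\<lambda>(C, us). (insert {k} C, us)) (configs L R A)"
  by (auto simp: inj_on_def dest: config_not_in(3)[where X = "{}"]) (metis config_not_in(3) insert_ident)+

lemma inj_create: "inj_on (\<lambda>(C, us). (C, {k} # us)) (configs L R A)"
  by (auto simp: inj_on_def)

lemma inj_annihilate:
  "inj_on (\<lambda>((C, us), i). (insert (insert k (us ! i)) C, remove_nth i us))
    (SIGMA s:configs L R A. {..<length (snd s)})" (is "inj_on ?f ?S")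
proof (rule inj_onI)
  fix x y assume x: "x \<in> ?S" and y: "y \<in> ?S" and eq: "?f x = ?f y"
  obtain C us i C' us' i' where xy: "x = ((C, us), i)" "y = ((C', us'), i')" by (metis surj_pair)
  have c: "(C, us) \<in> configs L R A" "i < length us" and c': "(C', us') \<in> configs L R A" "i' < length us'"
    using x y xy by auto
  have eq: "insert (insert k (us ! i)) C = insert (insert k (us' ! i')) C'" "remove_nth i us = remove_nth i' us'"
    using eq xy by auto
  have "insert k (us ! i) = insert k (us' ! i')"
    using eq(1) config_not_in(3)[OF c'(1), of "us ! i"] by blast
  moreover from this have "C = C'"
    using eq(1) config_not_in(3)[OF c(1)] config_not_in(3)[OF c'(1)] by (metis insert_ident)
  ultimately show "x = y" using extension_determines[OF c c'] eq(2) xy by simp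
qed

lemma inj_preserve:
  "inj_on (\<lambda>((C, us), i). (C, insert k (us ! i) # remove_nth i us))
    (SIGMA s:configs L R A. {..<length (snd s)})"
  by (rule inj_onI) (auto dest: extension_determines)

end

section \<open>Crossings and nestings of the arc diagram\<close>

definition crossings :: "(nat \<times> nat) set \<Rightarrow> nat" where
  "crossings E = card {(a, b). a \<in> E \<and> b \<in> E \<and> fst a < fst b \<and> fst b < snd a \<and> snd a < snd b}"

definition nestings :: "(nat \<times> nat) set \<Rightarrow> nat" where
  "nestings E = card {(a, b). a \<in> E \<and> b \<in> E \<and> arc_nests a b}"

lemma card_pairs_insert:
  assumes "finite F" "x \<notin> F" "\<not> Q x x"
  shows "card {(a, b). a \<in> insert x F \<and> b \<in> insert x F \<and> Q a b} =
    card {(a, b). a \<in> F \<and> b \<in> F \<and> Q a b} + card {b \<in> F. Q x b} + card {a \<in> F. Q a x}"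
proof -
  define P X Y where "P = {(a, b). a \<in> F \<and> b \<in> F \<and> Q a b}"
    and "X = Pair x ` {b \<in> F. Q x b}" and "Y = (\<lambda>a. (a, x)) ` {a \<in> F. Q a x}"
  have fin: "finite P" "finite X" "finite Y"
    using assms(1) by (auto simp: P_def X_def Y_def intro: finite_subset[of _ "F \<times> F"])
  have dj: "P \<inter> X = {}" "(P \<union> X) \<inter> Y = {}"
    using assms(2) by (auto simp: P_def X_def Y_def)
  have "{(a, b). a \<in> insert x F \<and> b \<in> insert x F \<and> Q a b} = P \<union> X \<union> Y"
    using assms(3) by (auto simp: P_def X_def Y_def)
  moreover have "card (P \<union> X \<union> Y) = card P + card X + card Y"
    using fin dj by (simp add: card_Un_disjoint)
  moreover have "card X = card {b \<in> F. Q x b}" "card Y = card {a \<in> F. Q a x}"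
    by (simp_all add: X_def Y_def card_image inj_on_def)
  ultimately show ?thesis by (simp add: P_def)
qed

lemma crossings_insert:
  assumes "finite F" "x \<notin> F"
  shows "crossings (insert x F) = crossings F +
    card {b \<in> F. fst x < fst b \<and> fst b < snd x \<and> snd x < snd b} +
    card {a \<in> F. fst a < fst x \<and> fst x < snd a \<and> snd a < snd x}"
  unfolding crossings_def by (rule card_pairs_insert[OF assms]) simp

lemma nestings_insert:
  assumes "finite F" "x \<notin> F"
  shows "nestings (insert x F) = nestings F + card {b \<in> F. arc_nests x b} + card {a \<in> F. arc_nests a x}"
  unfolding nestings_def by (rule card_pairs_insert[OF assms]) (simp add: arc_nests_def)

text \<open>
  A half arc ending at the least point is short enough to meet no other arc, and the strict
  inequalities keep half arcs, which all start at \<open>0\<close>, from crossing or nesting each other.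
\<close>

lemma add_half_arc:
  assumes "finite E" "\<And>a. a \<in> E \<Longrightarrow> (fst a = 0 \<or> k \<le> fst a) \<and> k < snd a"
  shows "crossings (insert (0, k) E) = crossings E" "nestings (insert (0, k) E) = nestings E"
proof -
  have new: "(0, k) \<notin> E" using assms(2) by force
  have 1: "{b \<in> E. fst (0, k) < fst b \<and> fst b < snd (0, k) \<and> snd (0, k) < snd b} = {}"
    "{b \<in> E. arc_nests (0, k) b} = {}"
    using assms(2) by (force simp: arc_nests_def)+
  have 2: "{a \<in> E. fst a < fst (0::nat, k) \<and> fst (0::nat, k) < snd a \<and> snd a < snd (0::nat, k)} = {}"
    "{a \<in> E. arc_nests a (0, k)} = {}"
    by (auto simp: arc_nests_def)
  show "crossings (insert (0, k) E) = crossings E"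
    unfolding crossings_insert[OF assms(1) new] 1 2 by simp
  show "nestings (insert (0, k) E) = nestings E"
    unfolding nestings_insert[OF assms(1) new] 1 2 by simp
qed

text \<open>
  Moving the start of a half arc from \<open>0\<close> to \<open>k\<close> keeps its relation to every full arc, because full
  arcs start after \<open>k\<close>.  Only the relations to the other half arcs are new: these now start to the left
  of \<open>(k, m)\<close>, so they cross it if they end before \<open>m\<close> and nest it if they end after \<open>m\<close>.
\<close>

lemma attach_half_arc:
  assumes E: "finite E" "(0, m) \<in> E" "\<And>a. a \<in> E \<Longrightarrow> (fst a = 0 \<or> k < fst a) \<and> k < snd a" and k: "0 < k"
  shows "crossings (insert (k, m) (E - {(0, m)})) = crossings E + card {x. (0, x) \<in> E \<and> x < m}"
    and "nestings (insert (k, m) (E - {(0, m)})) = nestings E + card {x. (0, x) \<in> E \<and> m < x}"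
proof -
  \<comment> \<open>Both diagrams are compared with the set \<open>F\<close> of the arcs that stay.\<close>
  define F where "F = E - {(0, m)}"
  have F: "finite F" "(0, m) \<notin> F" "(k, m) \<notin> F" "E = insert (0, m) F"
    using E(1,2) E(3)[of "(k, m)"] k by (auto simp: F_def)
  have pos: "0 < fst a \<longleftrightarrow> k < fst a" "fst a < k \<longleftrightarrow> fst a = 0" "k < snd a" if "a \<in> F" for a
    using E(3)[of a] that k by (auto simp: F_def)
  have km: "k < m" using E(3)[OF E(2)] by simp
  have c1: "{b \<in> F. fst (k, m) < fst b \<and> fst b < snd (k, m) \<and> snd (k, m) < snd b} =
      {b \<in> F. fst (0, m) < fst b \<and> fst b < snd (0, m) \<and> snd (0, m) < snd b}"
    using pos(1) by auto
  have c2: "{a \<in> F. fst a < fst (k, m) \<and> fst (k, m) < snd a \<and> snd a < snd (k, m)} =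
      Pair 0 ` {x. (0, x) \<in> E \<and> x < m}" (is "?l = _")
  proof -
    have "?l = {a \<in> E. fst a = 0 \<and> snd a < m}" using pos(2,3) k by (auto simp: F_def)
    also have "\<dots> = Pair 0 ` {x. (0, x) \<in> E \<and> x < m}" by (auto simp: image_iff)
    finally show ?thesis .
  qed
  have c3: "{a \<in> F. fst a < fst (0::nat, m) \<and> fst (0::nat, m) < snd a \<and> snd a < snd (0::nat, m)} = {}"
    by auto
  have n1: "{b \<in> F. arc_nests (k, m) b} = {b \<in> F. arc_nests (0, m) b}"
    using pos(1) by (auto simp: arc_nests_def)
  have n2: "{a \<in> F. arc_nests a (k, m)} = Pair 0 ` {x. (0, x) \<in> E \<and> m < x}"
      (is "?l = _")
  proof -
    have "?l = {a \<in> E. fst a = 0 \<and> m < snd a}" using pos(2) k km by (auto simp: F_def arc_nests_def)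
    also have "\<dots> = Pair 0 ` {x. (0, x) \<in> E \<and> m < x}" by (auto simp: image_iff)
    finally show ?thesis .
  qed
  have n3: "{a \<in> F. arc_nests a (0, m)} = {}"
    by (auto simp: arc_nests_def)
  show "crossings (insert (k, m) (E - {(0, m)})) = crossings E + card {x. (0, x) \<in> E \<and> x < m}"
    using crossings_insert[OF F(1,3)] crossings_insert[OF F(1,2)] arg_cong[OF c1, of card]
    unfolding F_def[symmetric] c1 c2 c3 F(4)[symmetric] by (simp add: card_image inj_on_def)
  show "nestings (insert (k, m) (E - {(0, m)})) = nestings E + card {x. (0, x) \<in> E \<and> m < x}"
    using nestings_insert[OF F(1,3)] nestings_insert[OF F(1,2)]
    unfolding F_def[symmetric] n1 n2 n3 F(4)[symmetric] by (simp add: card_image inj_on_def)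
qed

lemma arcs_subset: "arcs B \<subseteq> {(i, j). i \<in> B \<and> j \<in> B \<and> i < j}"
  by (auto simp: arcs_def)

lemma arcs_singleton: "arcs {k} = {}"
  by (auto simp: arcs_def)

lemma arcs_insert_least:
  assumes "finite B" "B \<noteq> {}" "\<And>x. x \<in> B \<Longrightarrow> k < x"
  shows "arcs (insert k B) = insert (k, Min B) (arcs B)"
proof (intro equalityI subsetI)
  fix a assume a: "a \<in> arcs (insert k B)"
  obtain i j where ij: "a = (i, j)" by (cases a)
  show "a \<in> insert (k, Min B) (arcs B)"
  proof (cases "i = k")
    case True
    then have j: "j \<in> B" "\<forall>x\<in>B. \<not> x < j" using a assms(3) by (auto simp: arcs_def ij)
    then have "Min B = j" using assms(1) by (intro Min_eqI) (auto simp: not_less)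
    then show ?thesis using True ij by simp
  next
    case False
    then show ?thesis using a assms(3) by (auto simp: arcs_def ij dest: less_asym)
  qed
next
  fix a assume "a \<in> insert (k, Min B) (arcs B)"
  then show "a \<in> arcs (insert k B)"
  proof
    assume "a = (k, Min B)"
    then show ?thesis using assms Min_in[OF assms(1,2)] Min_le[OF assms(1)]
      by (auto simp: arcs_def not_less dest: leD)
  next
    assume "a \<in> arcs B"
    then show ?thesis using assms(3) by (auto simp: arcs_def dest: less_asym)
  qed
qed

text \<open>
  The arcs of all blocks, together with a half arc \<open>(0, m)\<close> for every open block with least element
  \<open>m\<close>.  The points that occur are positive, so the common start \<open>0\<close> lies to the left of them.
\<close>

definition diagram :: "config \<Rightarrow> (nat \<times> nat) set" where
  "diagram s = \<Union>(arcs ` (fst s \<union> set (snd s))) \<union> (\<lambda>B. (0, Min B)) ` set (snd s)"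

lemma same_block_arcs:
  assumes "a \<in> arcs B" "b \<in> arcs B"
  shows "\<not> arcs_cross a b" "\<not> arc_nests a b"
  using assms by (auto simp: arcs_def arcs_cross_def arc_nests_def)

text \<open>
  \<^const>\<open>rc\<close> and \<^const>\<open>rnest\<close> count unordered pairs; listing the arc with the smaller start first orients each
  pair in a unique way.
\<close>

lemma card_unordered_pairs:
  assumes "\<And>a b. (a, b) \<in> S \<Longrightarrow> fst a < fst b"
  shows "card {{a, b} | a b. (a, b) \<in> S \<or> (b, a) \<in> S} = card (S :: ((nat \<times> nat) \<times> nat \<times> nat) set)"
proof -
  have "{{a, b} | a b. (a, b) \<in> S \<or> (b, a) \<in> S} = (\<lambda>(a, b). {a, b}) ` S"
    by (auto simp: image_iff insert_commute)
  moreover have "inj_on (\<lambda>(a, b). {a, b}) S"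
    by (auto simp: inj_on_def doubleton_eq_iff dest!: assms)
  ultimately show ?thesis by (simp add: card_image)
qed

lemma rc_eq_crossings: "rc \<rho> = crossings (diagram (\<rho>, []))"
proof -
  define S where "S = {(a, b). a \<in> diagram (\<rho>, []) \<and> b \<in> diagram (\<rho>, []) \<and> fst a < fst b \<and> fst b < snd a \<and> snd a < snd b}"
  have "(\<exists>B\<in>\<rho>. \<exists>B'\<in>\<rho>. B \<noteq> B' \<and> a \<in> arcs B \<and> b \<in> arcs B' \<and> arcs_cross a b) \<longleftrightarrow> (a, b) \<in> S \<or> (b, a) \<in> S" for a b
  proof -
    have "(a, b) \<in> S \<or> (b, a) \<in> S \<longleftrightarrow> a \<in> diagram (\<rho>, []) \<and> b \<in> diagram (\<rho>, []) \<and> arcs_cross a b"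
      by (auto simp: S_def arcs_cross_def)
    also have "\<dots> \<longleftrightarrow> (\<exists>B\<in>\<rho>. a \<in> arcs B) \<and> (\<exists>B\<in>\<rho>. b \<in> arcs B) \<and> arcs_cross a b"
      by (simp add: diagram_def)
    finally show ?thesis using same_block_arcs(1)[of a _ b] by metis
  qed
  then have "rc \<rho> = card {{a, b} | a b. (a, b) \<in> S \<or> (b, a) \<in> S}" by (simp add: rc_def)
  also have "\<dots> = card S" by (rule card_unordered_pairs) (simp add: S_def)
  finally show ?thesis by (simp add: S_def crossings_def)
qed

lemma rnest_eq_nestings: "rnest \<rho> = nestings (diagram (\<rho>, []))"
proof -
  define S where "S = {(a, b). a \<in> diagram (\<rho>, []) \<and> b \<in> diagram (\<rho>, []) \<and> arc_nests a b}"
  have "(\<exists>B\<in>\<rho>. \<exists>B'\<in>\<rho>. B \<noteq> B' \<and> a \<in> arcs B \<and> b \<in> arcs B' \<and> (arc_nests a b \<or> arc_nests b a)) \<longleftrightarrow>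
      (a, b) \<in> S \<or> (b, a) \<in> S" for a b
  proof -
    have "(a, b) \<in> S \<or> (b, a) \<in> S \<longleftrightarrow>
        a \<in> diagram (\<rho>, []) \<and> b \<in> diagram (\<rho>, []) \<and> (arc_nests a b \<or> arc_nests b a)"
      by (auto simp: S_def)
    also have "\<dots> \<longleftrightarrow> (\<exists>B\<in>\<rho>. a \<in> arcs B) \<and> (\<exists>B\<in>\<rho>. b \<in> arcs B) \<and> (arc_nests a b \<or> arc_nests b a)"
      by (simp add: diagram_def)
    finally show ?thesis using same_block_arcs(2)[of a _ b] same_block_arcs(2)[of b _ a] by metis
  qed
  then have "rnest \<rho> = card {{a, b} | a b. (a, b) \<in> S \<or> (b, a) \<in> S}" by (simp add: rnest_def)
  also have "\<dots> = card S" by (rule card_unordered_pairs) (simp add: S_def arc_nests_def)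
  finally show ?thesis by (simp add: S_def nestings_def)
qed

lemma card_below_nth:
  assumes "sorted_wrt (<) (xs :: nat list)" "i < length xs"
  shows "card {x \<in> set xs. x < xs ! i} = i" "card {x \<in> set xs. xs ! i < x} = length xs - 1 - i"
proof -
  have d: "distinct xs" using assms(1) by (simp add: strict_sorted_iff)
  have mono: "xs ! a < xs ! b \<longleftrightarrow> a < b" if "a < length xs" "b < length xs" for a b
    using that sorted_wrt_nth_less[OF assms(1), of a b] sorted_wrt_nth_less[OF assms(1), of b a]
    by (cases a b rule: linorder_cases) auto
  have filter_nth: "{x \<in> set xs. Q x} = (!) xs ` {j. j < length xs \<and> Q (xs ! j)}" for Q
    by (auto simp: in_set_conv_nth image_iff)
  have "{j. j < length xs \<and> xs ! j < xs ! i} = {..<i}" using mono assms(2) by auto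
  then have "{x \<in> set xs. x < xs ! i} = (!) xs ` {..<i}" unfolding filter_nth by simp
  then show "card {x \<in> set xs. x < xs ! i} = i"
    using d assms(2) by (simp add: card_image inj_on_nth)
  have "{j. j < length xs \<and> xs ! i < xs ! j} = {Suc i..<length xs}" using mono assms(2) by auto
  then have "{x \<in> set xs. xs ! i < x} = (!) xs ` {Suc i..<length xs}" unfolding filter_nth by simp
  then show "card {x \<in> set xs. xs ! i < x} = length xs - 1 - i"
    using d assms(2) by (simp add: card_image inj_on_nth)
qed

context new_point
begin

lemma diagram_bounds:
  assumes "(C, us) \<in> configs L R A" and a: "a \<in> diagram (C, us)"
  shows "fst a = 0 \<or> k < fst a" "k < snd a"
proof -
  note d = configsD[OF assms(1)]
  from a consider B where "B \<in> C \<union> set us" "a \<in> arcs B" | B where "B \<in> set us" "a = (0, Min B)"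
    by (auto simp: diagram_def)
  then have "(fst a = 0 \<or> k < fst a) \<and> k < snd a"
  proof cases
    case 1
    then have "B \<subseteq> A" using d(6,7) by blast
    then show ?thesis using 1(2) arcs_subset[of B] less_A by fastforce
  next
    case 2
    then have "k < Min B" using d(7,9) by (metis Min_gt)
    then show ?thesis using 2 by simp
  qed
  then show "fst a = 0 \<or> k < fst a" "k < snd a" by auto
qed

lemma finite_diagram:
  assumes "(C, us) \<in> configs L R A"
  shows "finite (diagram (C, us))"
proof (rule finite_subset)
  note d = configsD[OF assms]
  show "diagram (C, us) \<subseteq> A \<times> A \<union> (\<lambda>B. (0, Min B)) ` set us"
    using arcs_subset d(6,7) by (fastforce simp: diagram_def)
  show "finite (A \<times> A \<union> (\<lambda>B. (0, Min B)) ` set us)" using finite_A by simp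
qed

lemma half_arcs:
  assumes "(C, us) \<in> configs L R A" "0 \<notin> A"
  shows "(0, x) \<in> diagram (C, us) \<longleftrightarrow> x \<in> set (map Min us)"
proof -
  have "(0, x) \<notin> arcs B" if "B \<in> C \<union> set us" for B
    using that arcs_subset[of B] configsD(6,7)[OF assms(1)] assms(2) by blast
  then show ?thesis by (auto simp: diagram_def)
qed

lemma min_sorted_Min: "min_sorted us \<Longrightarrow> sorted_wrt (<) (map Min us)"
  by (simp add: min_sorted_def sorted_wrt_map)

lemma diagram_isolated: "diagram (insert {k} C, us) = diagram (C, us)"
  by (simp add: diagram_def arcs_singleton)

lemma diagram_create: "diagram (C, {k} # us) = insert (0, k) (diagram (C, us))"
  by (simp add: diagram_def arcs_singleton)

lemma diagram_attach:
  assumes c: "(C, us) \<in> configs L R A" "i < length us" and A0: "0 \<notin> A"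
  shows "diagram (insert (insert k (us ! i)) C, remove_nth i us) =
      insert (k, Min (us ! i)) (diagram (C, us) - {(0, Min (us ! i))})"
    and "diagram (C, insert k (us ! i) # remove_nth i us) =
      insert (0, k) (insert (k, Min (us ! i)) (diagram (C, us) - {(0, Min (us ! i))}))"
proof -
  note d = configsD[OF c(1)] and sp = open_block_split[OF c] and r = min_sorted_remove_nth[OF d(3) c(2)]
  define B vs where "B = us ! i" and "vs = remove_nth i us"
  have eq: "set us = insert B (set vs)" "B \<notin> set vs" using r by (simp_all add: B_def vs_def)
  have no0: "(0, x) \<notin> arcs X" if "X \<in> C \<union> set us" for X x
    using that arcs_subset[of X] d(6,7) A0 by blast
  have minB: "Min X \<noteq> Min B" if "X \<in> set vs" for X
  proof -
    have "X \<noteq> B" "X \<in> set us" "B \<in> set us" using that eq by auto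
    moreover have "inj_on Min (set us)"
      using min_sorted_Min[OF d(3)] by (simp add: strict_sorted_iff distinct_map)
    ultimately show ?thesis by (auto dest: inj_onD)
  qed
  have diff: "diagram (C, us) - {(0, Min B)} = \<Union>(arcs ` (C \<union> set us)) \<union> (\<lambda>X. (0, Min X)) ` set vs"
    (is "_ = ?U")
  proof -
    have "(0, Min B) \<notin> ?U" using no0 minB by fastforce
    moreover have "diagram (C, us) = insert (0, Min B) ?U" by (simp add: diagram_def eq(1))
    ultimately show ?thesis by (metis Diff_insert_absorb)
  qed
  have ar: "arcs (insert k B) = insert (k, Min B) (arcs B)"
    using sp(3-6) by (intro arcs_insert_least) (auto simp: B_def)
  have mn: "Min (insert k B) = k" using d(7)[of B] eq by (intro min_new) auto
  show "diagram (insert (insert k (us ! i)) C, remove_nth i us) =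
      insert (k, Min (us ! i)) (diagram (C, us) - {(0, Min (us ! i))})"
    "diagram (C, insert k (us ! i) # remove_nth i us) =
      insert (0, k) (insert (k, Min (us ! i)) (diagram (C, us) - {(0, Min (us ! i))}))"
    unfolding B_def[symmetric] vs_def[symmetric] diff
    by (auto simp: diagram_def ar mn eq)
qed

lemma statistics_isolated:
  "crossings (diagram (insert {k} C, us)) = crossings (diagram (C, us))"
  "nestings (diagram (insert {k} C, us)) = nestings (diagram (C, us))"
  by (simp_all add: diagram_isolated)

lemma statistics_create:
  assumes "(C, us) \<in> configs L R A"
  shows "crossings (diagram (C, {k} # us)) = crossings (diagram (C, us))"
    "nestings (diagram (C, {k} # us)) = nestings (diagram (C, us))"
  unfolding diagram_create
  by (rule add_half_arc[OF finite_diagram[OF assms]]; use diagram_bounds[OF assms] in \<open>force intro: less_imp_le\<close>)+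

text \<open>
  The open blocks are listed by their minima, so exactly \<open>i\<close> half arcs end before the half arc of the
  block at position \<open>i\<close>, and \<open>length us - 1 - i\<close> end after it.
\<close>

lemma statistics_attach:
  assumes c: "(C, us) \<in> configs L R A" "i < length us" and A0: "0 \<notin> A" "0 < k"
  shows "crossings (diagram (insert (insert k (us ! i)) C, remove_nth i us)) = crossings (diagram (C, us)) + i"
    "nestings (diagram (insert (insert k (us ! i)) C, remove_nth i us)) = nestings (diagram (C, us)) + (length us - 1 - i)"
    "crossings (diagram (C, insert k (us ! i) # remove_nth i us)) = crossings (diagram (C, us)) + i"
    "nestings (diagram (C, insert k (us ! i) # remove_nth i us)) = nestings (diagram (C, us)) + (length us - 1 - i)"
proof -
  let ?E = "diagram (C, us)" and ?m = "Min (us ! i)"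
  let ?E' = "insert (k, ?m) (?E - {(0, ?m)})"
  note b = diagram_bounds[OF c(1)] and half = half_arcs[OF c(1) A0(1)]
  have m: "(0, ?m) \<in> ?E" using c(2) by (simp add: half)
  have "{x. (0, x) \<in> ?E \<and> x < ?m} = {x \<in> set (map Min us). x < map Min us ! i}"
    "{x. (0, x) \<in> ?E \<and> ?m < x} = {x \<in> set (map Min us). map Min us ! i < x}"
    using half c(2) by auto
  then have E': "crossings ?E' = crossings ?E + i" "nestings ?E' = nestings ?E + (length us - 1 - i)"
    using attach_half_arc[OF finite_diagram[OF c(1)] m _ A0(2)] b
      card_below_nth[OF min_sorted_Min[OF configsD(3)[OF c(1)]], of i] c(2) by simp_all
  have "finite ?E'" using finite_diagram[OF c(1)] by simp
  note half' = add_half_arc[OF this]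
  have *: "(fst a = 0 \<or> k \<le> fst a) \<and> k < snd a" if "a \<in> ?E'" for a
    using that b m by fastforce
  show "crossings (diagram (insert (insert k (us ! i)) C, remove_nth i us)) = crossings (diagram (C, us)) + i"
    "nestings (diagram (insert (insert k (us ! i)) C, remove_nth i us)) = nestings (diagram (C, us)) + (length us - 1 - i)"
    using E' by (simp_all add: diagram_attach[OF c A0(1)])
  show "crossings (diagram (C, insert k (us ! i) # remove_nth i us)) = crossings (diagram (C, us)) + i"
    "nestings (diagram (C, insert k (us ! i) # remove_nth i us)) = nestings (diagram (C, us)) + (length us - 1 - i)"
    unfolding diagram_attach[OF c A0(1)] E'[symmetric] using half'[OF *] by auto
qed

end

section \<open>Weighted sums of configurations in one Fock space\<close>

text \<open>
  The tensor factor \<open>T\<^sub>i\<^sub>1 \<cdots> T\<^sub>i\<^sub>m\<^sub>-\<^sub>1 \<xi>\<^sub>i\<^sub>m\<close> of an open block \<open>i\<^sub>1 < \<cdots> < i\<^sub>m\<close>.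
\<close>

definition block_vec :: "(nat \<Rightarrow> 'a::real_inner cplx) \<Rightarrow> (nat \<Rightarrow> 'a cplx \<Rightarrow> 'a cplx) \<Rightarrow> nat set \<Rightarrow> 'a cplx" where
  "block_vec \<xi> T B = (let is = sorted_list_of_set B in foldr T (butlast is) (\<xi> (last is)))"

definition open_vecs :: "(nat \<Rightarrow> 'a::real_inner cplx) \<Rightarrow> (nat \<Rightarrow> 'a cplx \<Rightarrow> 'a cplx) \<Rightarrow>
    config \<Rightarrow> 'a cplx list" where
  "open_vecs \<xi> T s = map (block_vec \<xi> T) (snd s)"

text \<open>
  Singletons are left out because their weights \<open>\<lambda>\<^sub>i\<close> are shared by the two tensor factors and
  enter only in the diagonal Fock space.
\<close>

definition config_weight :: "real \<Rightarrow> real \<Rightarrow> (nat \<Rightarrow> 'a::real_inner cplx) \<Rightarrow> (nat \<Rightarrow> 'a cplx \<Rightarrow> 'a cplx) \<Rightarrow>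
    config \<Rightarrow> complex" where
  "config_weight q t \<xi> T s = of_real (q ^ crossings (diagram s) * t ^ nestings (diagram s)) *
     (\<Prod>B | B \<in> fst s \<and> card B \<ge> 2. block_inner \<xi> T B)"

text \<open>
  The one-sided part of the intermediate vector that belongs to the choice of summands recorded by
  \<open>L\<close> and \<open>R\<close>.
\<close>

definition config_sum :: "real \<Rightarrow> real \<Rightarrow> (nat \<Rightarrow> 'a::real_inner cplx) \<Rightarrow> (nat \<Rightarrow> 'a cplx \<Rightarrow> 'a cplx) \<Rightarrow>
    nat set \<Rightarrow> nat set \<Rightarrow> nat set \<Rightarrow> 'a cplx list \<Rightarrow> complex" where
  "config_sum q t \<xi> T L R A fs =
     (\<Sum>s\<in>configs L R A. config_weight q t \<xi> T s * tens (open_vecs \<xi> T s) fs)"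

lemma sorted_list_of_set_insert_least:
  assumes "finite B" "\<And>x. x \<in> B \<Longrightarrow> k < (x::nat)"
  shows "sorted_list_of_set (insert k B) = k # sorted_list_of_set B"
proof -
  have "Min (insert k B) = k" using assms by (intro Min_eqI) (auto intro: less_imp_le)
  moreover have "insert k B - {k} = B" using assms(2) by blast
  ultimately show ?thesis using sorted_list_of_set_nonempty[of "insert k B"] assms(1) by simp
qed

lemma block_vec_singleton: "block_vec \<xi> T {k} = \<xi> k"
  by (simp add: block_vec_def)

lemma extend_block_vec:
  assumes "finite B" "B \<noteq> {}" "\<And>x. x \<in> B \<Longrightarrow> k < x"
  shows "block_vec \<xi> T (insert k B) = T k (block_vec \<xi> T B)"
    and "block_inner \<xi> T (insert k B) = cinner (\<xi> k) (block_vec \<xi> T B)"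
proof -
  have "sorted_list_of_set (insert k B) = k # sorted_list_of_set B"
    using assms(1,3) by (rule sorted_list_of_set_insert_least)
  moreover have "sorted_list_of_set B \<noteq> []" using assms(1,2) by simp
  ultimately show "block_vec \<xi> T (insert k B) = T k (block_vec \<xi> T B)"
    and "block_inner \<xi> T (insert k B) = cinner (\<xi> k) (block_vec \<xi> T B)"
    unfolding block_vec_def block_inner_def by (simp_all only: Let_def list.sel butlast.simps last.simps if_False foldr.simps o_apply)
qed

lemma block_vec_in:
  assumes "\<And>x. x \<in> B \<Longrightarrow> \<xi> x \<in> D" "\<And>x. x \<in> B \<Longrightarrow> operator_on D (T x)" "finite B" "B \<noteq> {}"
  shows "block_vec \<xi> T B \<in> D"
proof -
  have "foldr T xs u \<in> D" if "set xs \<subseteq> B" "u \<in> D" for xs u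
    using that assms(2) by (induction xs) (auto simp: operator_on_def image_subset_iff)
  moreover have "sorted_list_of_set B \<noteq> []" "set (sorted_list_of_set B) = B" using assms(3,4) by auto
  moreover from this have "set (butlast (sorted_list_of_set B)) \<subseteq> B" "last (sorted_list_of_set B) \<in> B"
    using in_set_butlastD[of _ "sorted_list_of_set B"] last_in_set[of "sorted_list_of_set B"] by auto
  ultimately show ?thesis using assms(1) by (simp add: block_vec_def Let_def)
qed

lemma open_vecs_in:
  assumes "(\<And>x. x \<in> A \<Longrightarrow> \<xi> x \<in> D)" "(\<And>x. x \<in> A \<Longrightarrow> operator_on D (T x))" "finite A" "s \<in> configs L R A"
  shows "open_vecs \<xi> T s \<in> lists D"
proof -
  obtain C us where s: "s = (C, us)" by (cases s)
  note d = configsD[of C us L R A]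
  have "block_vec \<xi> T B \<in> D" if B: "B \<in> set us" for B
  proof (rule block_vec_in)
    have sub: "B \<subseteq> A" using d(7) B assms(4) s by blast
    show "\<And>x. x \<in> B \<Longrightarrow> \<xi> x \<in> D" "\<And>x. x \<in> B \<Longrightarrow> operator_on D (T x)" using sub assms(1,2) by blast+
    show "finite B" using sub assms(3) by (rule finite_subset)
    show "B \<noteq> {}" using d(9) B assms(4) s by blast
  qed
  then show ?thesis by (auto simp: open_vecs_def s)
qed

lemma map_remove_nth: "map f (remove_nth i us) = remove_nth i (map f us)"
  by (simp add: remove_nth_def take_map drop_map)

context new_point
begin

lemma prod_block_inner_close:
  assumes c: "(C, us) \<in> configs L R A" "i < length us"
  shows "(\<Prod>B | B \<in> insert (insert k (us ! i)) C \<and> card B \<ge> 2. block_inner \<xi> T B) =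
    cinner (\<xi> k) (block_vec \<xi> T (us ! i)) * (\<Prod>B | B \<in> C \<and> card B \<ge> 2. block_inner \<xi> T B)"
proof -
  note sp = open_block_split[OF c]
  have "card (insert k (us ! i)) \<ge> 2" using sp(3-5) by (simp add: Suc_le_eq card_gt_0_iff)
  then have eq: "{B. B \<in> insert (insert k (us ! i)) C \<and> card B \<ge> 2} = insert (insert k (us ! i)) {B. B \<in> C \<and> card B \<ge> 2}"
    by auto
  have "finite C"
    using configsD(6)[OF c(1)] finite_A by (intro finite_subset[of C "Pow A"]) auto
  moreover have "block_inner \<xi> T (insert k (us ! i)) = cinner (\<xi> k) (block_vec \<xi> T (us ! i))"
    using sp(5,4,6) by (rule extend_block_vec)
  ultimately show ?thesis
    using config_not_in(3)[OF c(1)] unfolding eq by simp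
qed

lemma prod_block_inner_isolated:
  "(\<Prod>B | B \<in> insert {k} C \<and> card B \<ge> 2. block_inner \<xi> T B) = (\<Prod>B | B \<in> C \<and> card B \<ge> 2. block_inner \<xi> T B)"
  by (intro prod.cong) auto

text \<open>
  The following four facts say that applying the summand prescribed for \<open>k\<close> turns the sum over the
  configurations on \<open>A\<close> into the sum over those on \<open>insert k A\<close>.
\<close>

lemma config_sum_isolated: "config_sum q t \<xi> T L R (insert k A) fs = config_sum q t \<xi> T L R A fs"
  unfolding config_sum_def configs_isolated sum.reindex[OF inj_isolated]
  by (intro sum.cong refl)
    (clarsimp simp only: config_weight_def prod_block_inner_isolated statistics_isolated open_vecs_def o_apply fst_conv snd_conv prod.case)

lemma config_sum_create:
  "config_sum q t \<xi> T L (insert k R) (insert k A) fs =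
    (\<Sum>s\<in>configs L R A. config_weight q t \<xi> T s * creation (\<xi> k) (tens (open_vecs \<xi> T s)) fs)"
  unfolding config_sum_def configs_create sum.reindex[OF inj_create]
  by (intro sum.cong refl)
    (auto simp: config_weight_def statistics_create open_vecs_def block_vec_singleton creation_tens)

lemma config_sum_annihilate:
  assumes "0 \<notin> A" "0 < k"
  shows "config_sum q t \<xi> T (insert k L) R (insert k A) fs =
    (\<Sum>s\<in>configs L R A. config_weight q t \<xi> T s * annihilation q t (\<xi> k) (tens (open_vecs \<xi> T s)) fs)"
proof -
  let ?h = "\<lambda>s i. of_real (q ^ i * t ^ (length (snd s) - 1 - i)) * cinner (\<xi> k) (open_vecs \<xi> T s ! i) *
    tens (remove_nth i (open_vecs \<xi> T s)) fs"
  have "config_sum q t \<xi> T (insert k L) R (insert k A) fs =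
      (\<Sum>(s, i)\<in>(SIGMA s:configs L R A. {..<length (snd s)}). config_weight q t \<xi> T s * ?h s i)"
    unfolding config_sum_def configs_annihilate sum.reindex[OF inj_annihilate]
  proof (intro sum.cong refl, clarsimp)
    fix C us i assume c: "(C, us) \<in> configs L R A" "i < length us"
    show "config_weight q t \<xi> T (insert (insert k (us ! i)) C, remove_nth i us) *
        tens (open_vecs \<xi> T (insert (insert k (us ! i)) C, remove_nth i us)) fs =
      config_weight q t \<xi> T (C, us) * (complex_of_real q ^ i * complex_of_real t ^ (length us - Suc i) *
        cinner (\<xi> k) (open_vecs \<xi> T (C, us) ! i) * tens (remove_nth i (open_vecs \<xi> T (C, us))) fs)"
      using c unfolding config_weight_def fst_conv prod_block_inner_close[OF c] statistics_attach(1,2)[OF c assms] power_add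
      by (simp add: open_vecs_def map_remove_nth)
  qed
  also have "\<dots> = (\<Sum>s\<in>configs L R A. \<Sum>i<length (snd s). config_weight q t \<xi> T s * ?h s i)"
    using finite_configs[OF finite_A] by (intro sum.Sigma[symmetric]) auto
  finally show ?thesis
    by (simp add: annihilation_tens sum_distrib_left open_vecs_def)
qed

lemma config_sum_preserve:
  assumes "0 \<notin> A" "0 < k" and D: "cplx.subspace D" "operator_on D (T k)"
    and dom: "\<And>x. x \<in> A \<Longrightarrow> \<xi> x \<in> D" "\<And>x. x \<in> A \<Longrightarrow> operator_on D (T x)"
  shows "config_sum q t \<xi> T (insert k L) (insert k R) (insert k A) fs =
    (\<Sum>s\<in>configs L R A. config_weight q t \<xi> T s * preservation q t D (T k) (tens (open_vecs \<xi> T s)) fs)"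
proof -
  let ?h = "\<lambda>s i. of_real (q ^ i * t ^ (length (snd s) - 1 - i)) *
    tens (T k (open_vecs \<xi> T s ! i) # remove_nth i (open_vecs \<xi> T s)) fs"
  have "config_sum q t \<xi> T (insert k L) (insert k R) (insert k A) fs =
      (\<Sum>(s, i)\<in>(SIGMA s:configs L R A. {..<length (snd s)}). config_weight q t \<xi> T s * ?h s i)"
    unfolding config_sum_def configs_preserve sum.reindex[OF inj_preserve]
  proof (intro sum.cong refl, clarsimp)
    fix C us i assume c: "(C, us) \<in> configs L R A" "i < length us"
    note sp = open_block_split[OF c]
    have vec: "block_vec \<xi> T (insert k (us ! i)) = T k (block_vec \<xi> T (us ! i))"
      using sp(5,4,6) by (rule extend_block_vec)
    show "config_weight q t \<xi> T (C, insert k (us ! i) # remove_nth i us) *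
        tens (open_vecs \<xi> T (C, insert k (us ! i) # remove_nth i us)) fs =
      config_weight q t \<xi> T (C, us) * (complex_of_real q ^ i * complex_of_real t ^ (length us - Suc i) *
        tens (T k (open_vecs \<xi> T (C, us) ! i) # remove_nth i (open_vecs \<xi> T (C, us))) fs)"
      using c unfolding config_weight_def fst_conv statistics_attach(3,4)[OF c assms(1,2)] power_add
      by (simp add: open_vecs_def map_remove_nth vec)
  qed
  also have "\<dots> = (\<Sum>s\<in>configs L R A. \<Sum>i<length (snd s). config_weight q t \<xi> T s * ?h s i)"
    using finite_configs[OF finite_A] by (intro sum.Sigma[symmetric]) auto
  also have "\<dots> = (\<Sum>s\<in>configs L R A. config_weight q t \<xi> T s * preservation q t D (T k) (tens (open_vecs \<xi> T s)) fs)"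
  proof (intro sum.cong refl)
    fix s assume "s \<in> configs L R A"
    then have "open_vecs \<xi> T s \<in> lists D" using open_vecs_in dom finite_A by blast
    from preservation_tens[OF D(2,1) this, of q t]
    show "(\<Sum>i<length (snd s). config_weight q t \<xi> T s * ?h s i) =
        config_weight q t \<xi> T s * preservation q t D (T k) (tens (open_vecs \<xi> T s)) fs"
      by (simp add: sum_distrib_left) (simp add: open_vecs_def)
  qed
  finally show ?thesis .
qed

end

section \<open>The operators on the diagonal Fock space\<close>

lemma sum_Pow_insert:
  assumes "finite A" "k \<notin> A"
  shows "(\<Sum>L\<in>Pow (insert k A). f L) = (\<Sum>L\<in>Pow A. f L) + (\<Sum>L\<in>Pow A. f (insert k L))"
proof -
  have "inj_on (insert k) (Pow A)" using assms(2) by (auto simp: inj_on_def insert_ident subset_iff)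
  moreover have "Pow A \<inter> insert k ` Pow A = {}" using assms(2) by auto
  ultimately show ?thesis
    using assms(1) by (simp add: Pow_insert sum.union_disjoint sum.reindex)
qed

text \<open>
  Every block has one arc end less than elements unless it is open, and one arc start less than
  elements in any case.  So the number of open blocks is determined by \<open>L\<close> and \<open>R\<close>; this keeps the two
  tensor factors in the same degree.
\<close>

lemma length_open_blocks:
  assumes "finite A" "L \<subseteq> A" "R \<subseteq> A" "s \<in> configs L R A"
  shows "length (snd s) + card L = card R"
  using assms
proof (induction A arbitrary: L R s rule: finite_linorder_min_induct)
  case empty
  then show ?case by (auto simp: configs_empty)
next
  case (insert k A)
  \<comment> \<open>The type of \<open>s\<close> restricted to the earlier points.\<close>
  define L0 R0 where "L0 = L - {k}" and "R0 = R - {k}"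
  interpret new_point k A L0 R0
    using insert.hyps insert.prems by unfold_locales (auto simp: L0_def R0_def)
  have IH: "length us + card L0 = card R0" if "(C, us) \<in> configs L0 R0 A" for C us
    using insert.IH[OF LR that] by simp
  have card: "card (insert k L0) = Suc (card L0)" "card (insert k R0) = Suc (card R0)"
    using not_in LR finite_A by (auto simp: finite_subset)
  consider "L = L0" "R = R0" | "L = L0" "R = insert k R0" | "L = insert k L0" "R = R0" | "L = insert k L0" "R = insert k R0"
    by (auto simp: L0_def R0_def)
  then show ?case
  proof cases
    case 1
    then show ?thesis using insert.prems(3) IH by (auto simp: configs_isolated)
  next
    case 2
    then show ?thesis using insert.prems(3) IH card by (auto simp: configs_create)
  next
    case 3
    then show ?thesis using insert.prems(3) IH card
      by (fastforce simp: configs_annihilate length_remove_nth)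
  next
    case 4
    then show ?thesis using insert.prems(3) IH card
      by (fastforce simp: configs_preserve length_remove_nth)
  qed
qed

text \<open>
  Linearity of the operators for sums over an arbitrary family, in which a tensor may
  occur several times.
\<close>

lemma op_tensor_family:
  assumes S: "lin_compatible tens (lists D) (\<lambda>us. S (tens us))"
    and S': "lin_compatible tens (lists D') (\<lambda>vs. S' (tens vs))"
    and I: "finite I" "\<And>i. i \<in> I \<Longrightarrow> u i \<in> diag_index D D'"
  shows "op_tensor D D' S S' (\<lambda>x. \<Sum>i\<in>I. c i * dtens (u i) x) =
    (\<lambda>y. \<Sum>i\<in>I. c i * tprod (S (tens (fst (u i)))) (S' (tens (snd (u i)))) y)"
proof -
  define d where "d j = (\<Sum>i | i \<in> I \<and> u i = j. c i)" for j
  have group: "(\<Sum>i\<in>I. c i * h (u i)) = (\<Sum>j\<in>u ` I. d j * h j)" for h :: "_ \<Rightarrow> complex"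
  proof -
    have "(\<Sum>i\<in>I. c i * h (u i)) = (\<Sum>j\<in>u ` I. \<Sum>i | i \<in> I \<and> u i = j. c i * h (u i))"
      by (rule sum.image_gen[OF I(1)])
    also have "\<dots> = (\<Sum>j\<in>u ` I. d j * h j)"
      unfolding d_def sum_distrib_right by (intro sum.cong) auto
    finally show ?thesis .
  qed
  have "u ` I \<subseteq> diag_index D D'" using I(2) by auto
  with op_tensor_sum[OF S S' finite_imageI[OF I(1)] this, of d] show ?thesis
    by (simp only: group[of "\<lambda>j. dtens j _"] group[of "\<lambda>j. tprod (S (tens (fst j))) (S' (tens (snd j))) _"])
qed

text \<open>
  The algebraic diagonal Fock space.
\<close>

definition fock_span :: "('a::real_inner cplx list \<times> 'b::real_inner cplx list \<Rightarrow> complex) set" where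
  "fock_span = {F. \<exists>J c. finite J \<and> J \<subseteq> diag_index UNIV UNIV \<and> F = (\<lambda>x. \<Sum>i\<in>J. c i * dtens i x)}"

lemma fock_span_dtens: "length us = length vs \<Longrightarrow> dtens (us, vs) \<in> fock_span"
  unfolding fock_span_def by (intro CollectI exI[of _ "{(us, vs)}"] exI[of _ "\<lambda>_. 1"]) (simp add: diag_index_def)

lemma fock_span_scale:
  assumes "F \<in> fock_span"
  shows "(\<lambda>x. c * F x) \<in> fock_span"
proof -
  obtain J b where "finite J" "J \<subseteq> diag_index UNIV UNIV" "F = (\<lambda>x. \<Sum>i\<in>J. b i * dtens i x)"
    using assms by (auto simp: fock_span_def)
  then show ?thesis unfolding fock_span_def
    by (intro CollectI exI[of _ J] exI[of _ "\<lambda>i. c * b i"]) (simp add: sum_distrib_left mult_ac)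
qed

lemma fock_span_add:
  assumes "F \<in> fock_span" "G \<in> fock_span"
  shows "(\<lambda>x. F x + G x) \<in> fock_span"
proof -
  obtain J b K c where J: "finite J" "J \<subseteq> diag_index UNIV UNIV" "F = (\<lambda>x. \<Sum>i\<in>J. b i * dtens i x)"
    and K: "finite K" "K \<subseteq> diag_index UNIV UNIV" "G = (\<lambda>x. \<Sum>i\<in>K. c i * dtens i x)"
    using assms by (auto simp: fock_span_def)
  define d where "d i = (if i \<in> J then b i else 0) + (if i \<in> K then c i else 0)" for i
  have "F x = (\<Sum>i\<in>J \<union> K. (if i \<in> J then b i else 0) * dtens i x)" for x
    unfolding J(3) using J(1) K(1) by (intro sum.mono_neutral_cong_left) auto
  moreover have "G x = (\<Sum>i\<in>J \<union> K. (if i \<in> K then c i else 0) * dtens i x)" for x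
    unfolding K(3) using J(1) K(1) by (intro sum.mono_neutral_cong_left) auto
  ultimately have "(\<lambda>x. F x + G x) = (\<lambda>x. \<Sum>i\<in>J \<union> K. d i * dtens i x)"
    by (simp add: d_def distrib_right sum.distrib)
  then show ?thesis using J K unfolding fock_span_def by blast
qed

lemma fock_span_sum:
  assumes "\<And>i. i \<in> I \<Longrightarrow> F i \<in> fock_span"
  shows "(\<lambda>x. \<Sum>i\<in>I. c i * F i x) \<in> fock_span"
  using assms
proof (induction I rule: infinite_finite_induct)
  case (insert i I)
  then show ?case using fock_span_add[OF fock_span_scale[of "F i" "c i"], of "\<lambda>x. \<Sum>i\<in>I. c i * F i x"] by simp
qed (use fock_span_scale[OF fock_span_dtens[of "[]" "[]"], of 0] in simp_all)

text \<open>
  The value of a form at a pair of lists is its inner product with the tensor of these lists; the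
  pair of empty lists belongs to the vacuum.
\<close>

lemma tensor_inner_vacuum:
  fixes G :: "'a::real_inner cplx list \<times> 'b::real_inner cplx list \<Rightarrow> complex"
  assumes "G \<in> fock_span"
  shows "tensor_inner diag_vacuum G = G ([], [])"
proof -
  obtain K d where K: "finite K" "K \<subseteq> diag_index UNIV UNIV" "G = (\<lambda>x. \<Sum>i\<in>K. d i * dtens i x)"
    using assms by (auto simp: fock_span_def)
  let ?J = "{([], [])} :: ('a cplx list \<times> 'b cplx list) set"
  have "diag_vacuum = (\<lambda>x. \<Sum>i\<in>?J. 1 * dtens i x)"
    by (simp add: diag_vacuum_def dtens_def)
  moreover have "?J \<subseteq> diag_index UNIV UNIV" by (simp add: diag_index_def)
  ultimately show ?thesis
    using tensor_inner_sum[of ?J K "\<lambda>_. 1" d] K by simp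
qed

lemma fock_span_symmetrized:
  assumes "length us = length vs"
  shows "tprod (symmetrizer q t (tens us)) (symmetrizer v w (tens vs)) \<in> fock_span"
proof -
  define c where "c q t n \<sigma> = complex_of_real (q ^ inversions n \<sigma> * t ^ ((n choose 2) - inversions n \<sigma>))" for q t n \<sigma>
  have "tprod (symmetrizer q t (tens us)) (symmetrizer v w (tens vs)) =
      (\<lambda>x. \<Sum>\<sigma> | \<sigma> permutes {..<length us}. c q t (length us) \<sigma> *
        (\<Sum>\<tau> | \<tau> permutes {..<length vs}. c v w (length vs) \<tau> * dtens (permute_list \<sigma> us, permute_list \<tau> vs) x))"
    by (intro ext, clarsimp simp: tprod_def dtens_def symmetrizer_tens c_def sum_distrib_right)
      (intro sum.cong refl, simp add: sum_distrib_left mult_ac)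
  also have "\<dots> \<in> fock_span"
    using assms by (intro fock_span_sum fock_span_dtens) simp
  finally show ?thesis .
qed

text \<open>
  The symmetrizer preserves the degree and is the identity in degree \<open>0\<close>, so the deformation of the
  inner product does not affect the vacuum component.
\<close>

lemma symmetrizer_vacuum: "symmetrizer q t (tens us) [] = tens us []"
proof (cases us)
  case Nil
  then show ?thesis by (simp add: symmetrizer_tens inversions_def binomial_eq_0)
next
  case (Cons u us')
  then show ?thesis by (simp add: symmetrizer_tens tens_length)
qed

lemma lin_compatible_preservation_op:
  assumes "operator_on D T" "cplx.subspace D"
  shows "lin_compatible tens (lists D) (\<lambda>us. preservation q t D T (tens us))"
  by (rule lin_compatible_op_basis[OF lin_compatible_preservation[OF assms] subset_refl preservation_tens[OF assms]])

text \<open>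
  The intermediate vector after all points of \<open>A\<close> have been met.
\<close>

definition fock_sum :: "real \<Rightarrow> real \<Rightarrow> real \<Rightarrow> real \<Rightarrow>
    (nat \<Rightarrow> 'a::real_inner cplx) \<Rightarrow> (nat \<Rightarrow> 'b::real_inner cplx) \<Rightarrow>
    (nat \<Rightarrow> 'a cplx \<Rightarrow> 'a cplx) \<Rightarrow> (nat \<Rightarrow> 'b cplx \<Rightarrow> 'b cplx) \<Rightarrow>
    (nat \<Rightarrow> real) \<Rightarrow> (nat \<Rightarrow> real) \<Rightarrow> nat set \<Rightarrow> 'a cplx list \<times> 'b cplx list \<Rightarrow> complex" where
  "fock_sum q t v w \<xi> \<xi>' T T' l l' A = (\<lambda>(fs, gs). \<Sum>L\<in>Pow A. \<Sum>R\<in>Pow A.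
     (\<Prod>x\<in>A - L - R. of_real (l x * l' x)) * (config_sum q t \<xi> T L R A fs * config_sum v w \<xi>' T' L R A gs))"

locale fock_setting =
  fixes q t v w :: real
    and D :: "'a::real_inner cplx set" and D' :: "'b::real_inner cplx set"
    and \<xi> :: "nat \<Rightarrow> 'a cplx" and \<xi>' :: "nat \<Rightarrow> 'b cplx"
    and T :: "nat \<Rightarrow> 'a cplx \<Rightarrow> 'a cplx" and T' :: "nat \<Rightarrow> 'b cplx \<Rightarrow> 'b cplx"
    and l l' :: "nat \<Rightarrow> real" and N :: "nat set"
  assumes D: "cplx.subspace D" "cplx.subspace D'"
    and \<xi>_in: "\<And>x. x \<in> N \<Longrightarrow> \<xi> x \<in> D" "\<And>x. x \<in> N \<Longrightarrow> \<xi>' x \<in> D'"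
    and T_on: "\<And>x. x \<in> N \<Longrightarrow> operator_on D (T x)" "\<And>x. x \<in> N \<Longrightarrow> operator_on D' (T' x)"
    and pos: "0 \<notin> N"
begin

abbreviation "state \<equiv> fock_sum q t v w \<xi> \<xi>' T T' l l'"

text \<open>
  The intermediate vector is a finite linear combination of elementary tensors of the domain; the
  image under a tensor product of operators is given both as a sum over this family, which shows that
  it lies in the Fock space, and factorised for each \<open>(L, R)\<close>, which is the form needed for
  the recursion.
\<close>

lemma op_tensor_state_family:
  fixes S :: "('a cplx list \<Rightarrow> complex) \<Rightarrow> 'a cplx list \<Rightarrow> complex"
    and S' :: "('b cplx list \<Rightarrow> complex) \<Rightarrow> 'b cplx list \<Rightarrow> complex"
  assumes S: "lin_compatible tens (lists E) (\<lambda>us. S (tens us))"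
    and S': "lin_compatible tens (lists E') (\<lambda>vs. S' (tens vs))"
    and E: "D \<subseteq> E" "D' \<subseteq> E'" and A: "finite A" "A \<subseteq> N"
  obtains I :: "((nat set \<times> nat set) \<times> config \<times> config) set" and c u where "finite I" "\<And>i. i \<in> I \<Longrightarrow> u i \<in> diag_index E E'"
    "op_tensor E E' S S' (state A) = (\<lambda>y. \<Sum>i\<in>I. c i * tprod (S (tens (fst (u i)))) (S' (tens (snd (u i)))) y)"
    "op_tensor E E' S S' (state A) = (\<lambda>(fs, gs). \<Sum>L\<in>Pow A. \<Sum>R\<in>Pow A. (\<Prod>x\<in>A - L - R. of_real (l x * l' x)) *
      ((\<Sum>s\<in>configs L R A. config_weight q t \<xi> T s * S (tens (open_vecs \<xi> T s)) fs) *
       (\<Sum>s\<in>configs L R A. config_weight v w \<xi>' T' s * S' (tens (open_vecs \<xi>' T' s)) gs)))"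
proof -
  define I where "I = (SIGMA (L, R):Pow A \<times> Pow A. configs L R A \<times> configs L R A)"
  define c where "c = (\<lambda>((L, R), s, s'). (\<Prod>x\<in>A - L - R. complex_of_real (l x * l' x)) *
    (config_weight q t \<xi> T s * config_weight v w \<xi>' T' s'))"
  define u where "u = (\<lambda>((L::nat set, R::nat set), s, s'). (open_vecs \<xi> T s, open_vecs \<xi>' T' s'))"
  have I: "finite I" using A(1) by (auto simp: I_def finite_configs)
  have expand: "(\<Sum>L\<in>Pow A. \<Sum>R\<in>Pow A. (\<Prod>x\<in>A - L - R. of_real (l x * l' x)) *
      ((\<Sum>s\<in>configs L R A. config_weight q t \<xi> T s * f (open_vecs \<xi> T s)) *
       (\<Sum>s\<in>configs L R A. config_weight v w \<xi>' T' s * g (open_vecs \<xi>' T' s)))) =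
      (\<Sum>i\<in>I. c i * (f (fst (u i)) * g (snd (u i))))" for f g
  proof -
    have "(\<Sum>i\<in>I. h i) = (\<Sum>p\<in>Pow A \<times> Pow A. \<Sum>s\<in>(case p of (L, R) \<Rightarrow> configs L R A \<times> configs L R A). h (p, s))"
      for h :: "_ \<Rightarrow> complex"
      unfolding I_def using A(1) by (subst sum.Sigma) (auto simp: finite_configs)
    then have "(\<Sum>i\<in>I. c i * (f (fst (u i)) * g (snd (u i)))) =
        (\<Sum>(L, R)\<in>Pow A \<times> Pow A. \<Sum>(s, s')\<in>configs L R A \<times> configs L R A.
          c ((L, R), s, s') * (f (open_vecs \<xi> T s) * g (open_vecs \<xi>' T' s')))"
      by (auto simp: u_def intro!: sum.cong)
    moreover have "(\<Prod>x\<in>A - L - R. of_real (l x * l' x)) *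
      ((\<Sum>s\<in>configs L R A. config_weight q t \<xi> T s * f (open_vecs \<xi> T s)) *
       (\<Sum>s\<in>configs L R A. config_weight v w \<xi>' T' s * g (open_vecs \<xi>' T' s))) =
      (\<Sum>(s, s')\<in>configs L R A \<times> configs L R A.
          c ((L, R), s, s') * (f (open_vecs \<xi> T s) * g (open_vecs \<xi>' T' s')))" for L R
      unfolding sum_product unfolding sum_distrib_left sum.cartesian_product
      by (intro sum.cong refl) (auto simp: c_def mult_ac)
    ultimately show ?thesis by (simp only: sum.cartesian_product)
  qed
  have u: "u i \<in> diag_index E E'" if "i \<in> I" for i
  proof -
    obtain L R s s' where i: "i = ((L, R), s, s')" by (metis surj_pair)
    then have *: "L \<subseteq> A" "R \<subseteq> A" "s \<in> configs L R A" "s' \<in> configs L R A" using that by (auto simp: I_def)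
    have "open_vecs \<xi> T s \<in> lists D" "open_vecs \<xi>' T' s' \<in> lists D'"
      using open_vecs_in[OF _ _ A(1) *(3), of \<xi> D T] open_vecs_in[OF _ _ A(1) *(4), of \<xi>' D' T'] A(2) \<xi>_in T_on
      by blast+
    moreover have "length (snd s) = length (snd s')"
      using length_open_blocks[OF A(1) *(1,2,3)] length_open_blocks[OF A(1) *(1,2,4)] by simp
    ultimately show ?thesis using E by (auto simp: u_def i diag_index_def open_vecs_def)
  qed
  have "state A = (\<lambda>x. \<Sum>i\<in>I. c i * dtens (u i) x)"
  proof
    fix x :: "'a cplx list \<times> 'b cplx list"
    obtain fs gs where x: "x = (fs, gs)" by (cases x)
    show "state A x = (\<Sum>i\<in>I. c i * dtens (u i) x)"
      using expand[of "\<lambda>us. tens us fs" "\<lambda>vs. tens vs gs"]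
      by (simp add: x fock_sum_def config_sum_def dtens_def tprod_def)
  qed
  then have *: "op_tensor E E' S S' (state A) =
      (\<lambda>y. \<Sum>i\<in>I. c i * tprod (S (tens (fst (u i)))) (S' (tens (snd (u i)))) y)"
    by (simp only: op_tensor_family[OF S S' I u])
  have "op_tensor E E' S S' (state A) = (\<lambda>(fs, gs). \<Sum>L\<in>Pow A. \<Sum>R\<in>Pow A. (\<Prod>x\<in>A - L - R. of_real (l x * l' x)) *
      ((\<Sum>s\<in>configs L R A. config_weight q t \<xi> T s * S (tens (open_vecs \<xi> T s)) fs) *
       (\<Sum>s\<in>configs L R A. config_weight v w \<xi>' T' s * S' (tens (open_vecs \<xi>' T' s)) gs)))"
    unfolding * using expand[of "\<lambda>us. S (tens us) _" "\<lambda>vs. S' (tens vs) _"]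
    by (simp add: fun_eq_iff tprod_def)
  with I u * show ?thesis by (rule that)
qed

lemma op_tensor_state:
  assumes "lin_compatible tens (lists E) (\<lambda>us. S (tens us))" "lin_compatible tens (lists E') (\<lambda>vs. S' (tens vs))"
    and "D \<subseteq> E" "D' \<subseteq> E'" "finite A" "A \<subseteq> N"
  shows "op_tensor E E' S S' (state A) (fs, gs) = (\<Sum>L\<in>Pow A. \<Sum>R\<in>Pow A. (\<Prod>x\<in>A - L - R. of_real (l x * l' x)) *
      ((\<Sum>s\<in>configs L R A. config_weight q t \<xi> T s * S (tens (open_vecs \<xi> T s)) fs) *
       (\<Sum>s\<in>configs L R A. config_weight v w \<xi>' T' s * S' (tens (open_vecs \<xi>' T' s)) gs)))"
proof -
  have "op_tensor E E' S S' (state A) = (\<lambda>(fs, gs). \<Sum>L\<in>Pow A. \<Sum>R\<in>Pow A. (\<Prod>x\<in>A - L - R. of_real (l x * l' x)) *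
      ((\<Sum>s\<in>configs L R A. config_weight q t \<xi> T s * S (tens (open_vecs \<xi> T s)) fs) *
       (\<Sum>s\<in>configs L R A. config_weight v w \<xi>' T' s * S' (tens (open_vecs \<xi>' T' s)) gs)))"
    by (rule op_tensor_state_family[OF assms])
  then show ?thesis by simp
qed

abbreviation "field k \<equiv> field_op q t v w D D' (\<xi> k) (\<xi>' k) (T k) (T' k) (l k) (l' k)"

text \<open>
  One factor \<open>X\<^sub>k\<close>: its four summands correspond to the four ways in which \<open>k\<close> can belong to \<open>L\<close> and \<open>R\<close>,
  and the sum over subsets of \<open>insert k A\<close> splits accordingly.
\<close>

lemma field_op_state:
  assumes A: "finite A" "\<And>x. x \<in> A \<Longrightarrow> k < x" "insert k A \<subseteq> N"
  shows "field k (state A) = state (insert k A)"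
proof
  fix x :: "'a cplx list \<times> 'b cplx list"
  obtain fs gs where x: "x = (fs, gs)" by (cases x)
  let ?lam = "\<lambda>S. \<Prod>x\<in>S. complex_of_real (l x * l' x)"
  let ?V = "\<lambda>L R A. config_sum q t \<xi> T L R A fs * config_sum v w \<xi>' T' L R A gs"
  have AN: "A \<subseteq> N" and kN: "k \<in> N" using A(3) by auto
  then have kA: "k \<notin> A" "0 \<notin> A" "0 < k" using A(2) pos by (blast, blast, metis gr0I)
  note dom = \<xi>_in T_on
  have np: "new_point k A L R" if "L \<in> Pow A" "R \<in> Pow A" for L R
    using A that by unfold_locales auto
  note lc = lin_compatible_operators
  have sub: "A - insert k L - R = A - L - R" "A - L - insert k R = A - L - R" for L R
    using kA(1) by auto
  have drop: "insert k A - insert k L - R = A - L - R" "insert k A - L - insert k R = A - L - R" for L R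
    using kA(1) by auto
  have keep: "?lam (insert k A - L - R) = of_real (l k * l' k) * ?lam (A - L - R)" if "L \<in> Pow A" "R \<in> Pow A" for L R
  proof -
    have "insert k A - L - R = insert k (A - L - R)" "k \<notin> A - L - R" using that kA(1) by auto
    then show ?thesis using A(1) by simp
  qed
  have ann: "op_tensor D D' (annihilation q t (\<xi> k)) (annihilation v w (\<xi>' k)) (state A) (fs, gs) =
      (\<Sum>L\<in>Pow A. \<Sum>R\<in>Pow A. ?lam (insert k A - insert k L - R) * ?V (insert k L) R (insert k A))"
    unfolding op_tensor_state[OF lc(2) lc(2) subset_refl subset_refl A(1) AN] drop
    by (intro sum.cong refl) (simp add: new_point.config_sum_annihilate[OF np kA(2,3)])
  have cre: "op_tensor D D' (creation (\<xi> k)) (creation (\<xi>' k)) (state A) (fs, gs) =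
      (\<Sum>L\<in>Pow A. \<Sum>R\<in>Pow A. ?lam (insert k A - L - insert k R) * ?V L (insert k R) (insert k A))"
    unfolding op_tensor_state[OF lc(1) lc(1) subset_refl subset_refl A(1) AN] drop
    by (intro sum.cong refl) (simp add: new_point.config_sum_create[OF np])
  have pre: "op_tensor D D' (preservation q t D (T k)) (preservation v w D' (T' k)) (state A) (fs, gs) =
      (\<Sum>L\<in>Pow A. \<Sum>R\<in>Pow A. ?lam (insert k A - insert k L - insert k R) * ?V (insert k L) (insert k R) (insert k A))"
  proof -
    have "?V (insert k L) (insert k R) (insert k A) =
        (\<Sum>s\<in>configs L R A. config_weight q t \<xi> T s * preservation q t D (T k) (tens (open_vecs \<xi> T s)) fs) *
        (\<Sum>s\<in>configs L R A. config_weight v w \<xi>' T' s * preservation v w D' (T' k) (tens (open_vecs \<xi>' T' s)) gs)"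
      if "L \<in> Pow A" "R \<in> Pow A" for L R
      using dom kN AN
      by (intro arg_cong2[of _ _ _ _ "(*)"] new_point.config_sum_preserve[OF np[OF that] kA(2,3)] D) auto
    then show ?thesis
      unfolding op_tensor_state[OF lin_compatible_preservation_op[OF T_on(1)[OF kN] D(1)]
          lin_compatible_preservation_op[OF T_on(2)[OF kN] D(2)]
          subset_refl subset_refl A(1) AN] drop(1) sub
      by (intro sum.cong refl) simp
  qed
  have sca: "of_real (l k * l' k) * state A (fs, gs) =
      (\<Sum>L\<in>Pow A. \<Sum>R\<in>Pow A. ?lam (insert k A - L - R) * ?V L R (insert k A))"
    unfolding fock_sum_def prod.case sum_distrib_left
    by (intro sum.cong refl) (simp only: keep new_point.config_sum_isolated[OF np] mult.assoc)
  have split: "state (insert k A) (fs, gs) =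
      (\<Sum>L\<in>Pow A. \<Sum>R\<in>Pow A. ?lam (insert k A - L - R) * ?V L R (insert k A)) +
      (\<Sum>L\<in>Pow A. \<Sum>R\<in>Pow A. ?lam (insert k A - L - insert k R) * ?V L (insert k R) (insert k A)) +
      ((\<Sum>L\<in>Pow A. \<Sum>R\<in>Pow A. ?lam (insert k A - insert k L - R) * ?V (insert k L) R (insert k A)) +
      (\<Sum>L\<in>Pow A. \<Sum>R\<in>Pow A. ?lam (insert k A - insert k L - insert k R) * ?V (insert k L) (insert k R) (insert k A)))"
    unfolding fock_sum_def prod.case sum_Pow_insert[OF A(1) kA(1)] sum.distrib by (simp only: add_ac)
  show "field k (state A) x = state (insert k A) x"
    unfolding x field_op_def ann cre pre sca split by (simp only: add_ac)
qed

lemma state_empty: "state {} = diag_vacuum"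
proof
  fix x :: "'a cplx list \<times> 'b cplx list"
  obtain fs gs where x: "x = (fs, gs)" by (cases x)
  have z: "crossings {} = 0" "nestings {} = 0" by (simp_all add: crossings_def nestings_def)
  show "state {} x = diag_vacuum x"
    by (simp add: x fock_sum_def config_sum_def configs_empty config_weight_def diagram_def z
        open_vecs_def diag_vacuum_def tprod_def)
qed

lemma foldr_field_op:
  assumes "finite A" "A \<subseteq> N"
  shows "foldr field (sorted_list_of_set A) diag_vacuum = state A"
  using assms
proof (induction A rule: finite_linorder_min_induct)
  case empty
  then show ?case by (simp add: state_empty)
next
  case (insert k A)
  have "sorted_list_of_set (insert k A) = k # sorted_list_of_set A"
    using insert.hyps by (intro sorted_list_of_set_insert_least) auto
  moreover have "field k (state A) = state (insert k A)"
    using insert.hyps insert.prems by (intro field_op_state) auto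
  ultimately show ?case using insert.IH insert.prems by simp
qed

lemma fock_form_vacuum_state:
  assumes "finite A" "A \<subseteq> N"
  shows "fock_form q t v w diag_vacuum (state A) = state A ([], [])"
proof -
  have lc: "lin_compatible tens (lists UNIV) (\<lambda>us. symmetrizer q t (tens us :: 'a cplx list \<Rightarrow> complex))"
    "lin_compatible tens (lists UNIV) (\<lambda>us. symmetrizer v w (tens us :: 'b cplx list \<Rightarrow> complex))"
    by (rule lin_compatible_operators(4))+
  obtain I :: "((nat set \<times> nat set) \<times> config \<times> config) set" and c u where I: "\<And>i. i \<in> I \<Longrightarrow> u i \<in> diag_index UNIV UNIV"
    "op_tensor UNIV UNIV (symmetrizer q t) (symmetrizer v w) (state A) =
      (\<lambda>y. \<Sum>i\<in>I. c i * tprod (symmetrizer q t (tens (fst (u i)))) (symmetrizer v w (tens (snd (u i)))) y)"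
    by (rule op_tensor_state_family[OF lc subset_UNIV subset_UNIV assms]) (rule that, assumption+)
  have "op_tensor UNIV UNIV (symmetrizer q t) (symmetrizer v w) (state A) \<in> fock_span"
    unfolding I(2) using I(1) by (intro fock_span_sum fock_span_symmetrized) (auto simp: diag_index_def case_prod_unfold)
  then have "fock_form q t v w diag_vacuum (state A) =
      op_tensor UNIV UNIV (symmetrizer q t) (symmetrizer v w) (state A) ([], [])"
    unfolding fock_form_def by (rule tensor_inner_vacuum)
  also have "\<dots> = state A ([], [])"
    unfolding op_tensor_state[OF lc subset_UNIV subset_UNIV assms]
    by (simp add: symmetrizer_vacuum fock_sum_def config_sum_def)
  finally show ?thesis .
qed

end

section \<open>Diagonal partitions\<close>

definition typed_partitions :: "nat set \<Rightarrow> nat set \<Rightarrow> nat set \<Rightarrow> nat set set set" where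
  "typed_partitions L R A = {\<rho>. partition_on A \<rho> \<and> (\<forall>B\<in>\<rho>. closed_block L R B)}"

definition partition_amp :: "real \<Rightarrow> real \<Rightarrow> (nat \<Rightarrow> 'a::real_inner cplx) \<Rightarrow> (nat \<Rightarrow> 'a cplx \<Rightarrow> 'a cplx) \<Rightarrow>
    nat set set \<Rightarrow> complex" where
  "partition_amp q t \<xi> T \<rho> = of_real (q ^ rc \<rho> * t ^ rnest \<rho>) * (\<Prod>B | B \<in> \<rho> \<and> card B \<ge> 2. block_inner \<xi> T B)"

lemma config_sum_vacuum:
  assumes "finite A"
  shows "config_sum q t \<xi> T L R A [] = (\<Sum>\<rho>\<in>typed_partitions L R A. partition_amp q t \<xi> T \<rho>)"
proof -
  have "config_sum q t \<xi> T L R A [] = (\<Sum>s\<in>(\<lambda>\<rho>. (\<rho>, [])) ` typed_partitions L R A. config_weight q t \<xi> T s)"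
    unfolding config_sum_def
  proof (rule sum.mono_neutral_cong_right)
    show "finite (configs L R A)" using assms by (rule finite_configs)
  qed (auto simp: configs_def typed_partitions_def min_sorted_def tens_Nil_right open_vecs_def)
  also have "\<dots> = (\<Sum>\<rho>\<in>typed_partitions L R A. partition_amp q t \<xi> T \<rho>)"
    by (subst sum.reindex) (auto simp: inj_on_def config_weight_def partition_amp_def rc_eq_crossings rnest_eq_nestings)
  finally show ?thesis .
qed

lemma typed_block:
  assumes "finite A" "\<rho> \<in> typed_partitions L R A" "B \<in> \<rho>"
  shows "finite B" "Min B \<in> B" "Max B \<in> B" "B \<subseteq> A" "B \<inter> L = B - {Max B}" "B \<inter> R = B - {Min B}"
    "card B \<ge> 2 \<longleftrightarrow> Min B \<in> L" "card B = 1 \<longleftrightarrow> Min B \<notin> L" "Min B = Max B \<longleftrightarrow> B = {Min B}"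
proof -
  have part: "partition_on A \<rho>" and cl: "closed_block L R B"
    using assms by (auto simp: typed_partitions_def)
  show sub: "B \<subseteq> A" using part assms(3) by (auto simp: partition_on_def)
  then show fin: "finite B" using assms(1) by (rule finite_subset)
  have ne: "B \<noteq> {}" using part assms(3) by (auto simp: partition_on_def)
  show mn: "Min B \<in> B" "Max B \<in> B" using fin ne by simp_all
  show L: "B \<inter> L = B - {Max B}" and "B \<inter> R = B - {Min B}" using cl by (simp_all add: closed_block_def)
  show single: "Min B = Max B \<longleftrightarrow> B = {Min B}"
  proof
    assume "Min B = Max B"
    then have "x = Min B" if "x \<in> B" for x
      using Min_le[OF fin that] Max_ge[OF fin that] by simp
    then show "B = {Min B}" using mn(1) by blast
  next
    assume "B = {Min B}"
    then show "Min B = Max B" using mn(2) by (metis singletonD)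
  qed
  have "Min B \<in> L \<longleftrightarrow> B \<noteq> {Min B}" using L mn(1) single by blast
  moreover have "card B = 1 \<longleftrightarrow> B = {Min B}" using mn(1) by (metis One_nat_def card_1_singletonE is_singletonI is_singleton_altdef singletonD)
  moreover have "card B \<noteq> 0" using fin ne by simp
  ultimately show "card B \<ge> 2 \<longleftrightarrow> Min B \<in> L" "card B = 1 \<longleftrightarrow> Min B \<notin> L" by auto
qed

text \<open>
  The least element of a finished block is its only element at which no arc ends.
\<close>

lemma typed_bij_Min:
  assumes "finite A" "\<rho> \<in> typed_partitions L R A"
  shows "bij_betw Min \<rho> (A - R)"
proof (rule bij_betw_imageI)
  note b = typed_block[OF assms]
  have part: "partition_on A \<rho>" using assms by (simp add: typed_partitions_def)
  show "inj_on Min \<rho>"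
  proof (rule inj_onI)
    fix B B' assume B: "B \<in> \<rho>" "B' \<in> \<rho>" "Min B = Min B'"
    then have "Min B \<in> B \<inter> B'" using b(2)[OF B(1)] b(2)[OF B(2)] by simp
    then show "B = B'" using part B(1,2) by (auto simp: partition_on_def disjoint_def)
  qed
  show "Min ` \<rho> = A - R"
  proof (intro equalityI subsetI)
    fix x assume "x \<in> Min ` \<rho>"
    then show "x \<in> A - R" using b(2,4,6) by blast
  next
    fix x assume x: "x \<in> A - R"
    then obtain B where "B \<in> \<rho>" "x \<in> B" using part by (auto simp: partition_on_def)
    then show "x \<in> Min ` \<rho>" using b(6) x by blast
  qed
qed

text \<open>
  Two partitions with the same \<open>L\<close> and \<open>R\<close> have the same minima of blocks, so matching blocks
  by their minima is a bijection.  Matched blocks are singletons simultaneously, since a block is a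
  singleton if and only if no arc starts at its minimum.
\<close>

lemma prod_matched_blocks:
  assumes A: "finite A" and \<rho>: "\<rho> \<in> typed_partitions L R A" "\<rho>' \<in> typed_partitions L R A"
  shows "(\<Prod>b | fst b \<in> \<rho> \<and> snd b \<in> \<rho>' \<and> Min (fst b) = Min (snd b). block_weight \<xi> \<xi>' T T' l l' b) =
    (\<Prod>x\<in>A - L - R. of_real (l x * l' x)) *
    ((\<Prod>B | B \<in> \<rho> \<and> card B \<ge> 2. block_inner \<xi> T B) * (\<Prod>B | B \<in> \<rho>' \<and> card B \<ge> 2. block_inner \<xi>' T' B))"
proof -
  define S where "S = {b. fst b \<in> \<rho> \<and> snd b \<in> \<rho>' \<and> Min (fst b) = Min (snd b)}"
  note m = typed_bij_Min[OF A \<rho>(1)] and m' = typed_bij_Min[OF A \<rho>(2)]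
  note b = typed_block[OF A \<rho>(1)] and b' = typed_block[OF A \<rho>(2)]
  have fin: "finite \<rho>" "finite \<rho>'" using m m' A by (auto dest: bij_betw_finite)
  have f: "bij_betw fst S \<rho>" and s: "bij_betw snd S \<rho>'"
    using m m' unfolding S_def bij_betw_def inj_on_def by (auto simp: image_iff prod_eq_iff) (metis imageE imageI fst_conv snd_conv)+
  have fM: "bij_betw (Min \<circ> fst) S (A - R)" using f m by (rule bij_betw_trans)
  \<comment> \<open>Each weight is written as a product of a singleton factor and one factor for either block,
    the absent ones being \<open>1\<close>; every product can then be reindexed separately.\<close>
  have "block_weight \<xi> \<xi>' T T' l l' b = (if Min (fst b) \<in> L then 1 else of_real (l (Min (fst b)) * l' (Min (fst b)))) *
      ((if Min (fst b) \<in> L then block_inner \<xi> T (fst b) else 1) * (if Min (snd b) \<in> L then block_inner \<xi>' T' (snd b) else 1))"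
    if "b \<in> S" for b
    using that b(8)[of "fst b"] b'(8)[of "snd b"] by (auto simp: S_def block_weight_def case_prod_unfold)
  then have "(\<Prod>b\<in>S. block_weight \<xi> \<xi>' T T' l l' b) = (\<Prod>b\<in>S.
      (if Min (fst b) \<in> L then 1 else of_real (l (Min (fst b)) * l' (Min (fst b)))) *
      ((if Min (fst b) \<in> L then block_inner \<xi> T (fst b) else 1) * (if Min (snd b) \<in> L then block_inner \<xi>' T' (snd b) else 1)))"
    by (intro prod.cong refl)
  also have "\<dots> =
      (\<Prod>b\<in>S. if (Min \<circ> fst) b \<in> L then 1 else of_real (l ((Min \<circ> fst) b) * l' ((Min \<circ> fst) b))) *
      ((\<Prod>b\<in>S. if Min (fst b) \<in> L then block_inner \<xi> T (fst b) else 1) *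
       (\<Prod>b\<in>S. if Min (snd b) \<in> L then block_inner \<xi>' T' (snd b) else 1))"
    by (simp only: prod.distrib o_apply)
  also have "(\<Prod>b\<in>S. if (Min \<circ> fst) b \<in> L then 1 else of_real (l ((Min \<circ> fst) b) * l' ((Min \<circ> fst) b))) =
      (\<Prod>x\<in>A - R. if x \<in> L then 1 else complex_of_real (l x * l' x))"
    by (rule prod.reindex_bij_betw[OF fM])
  also have "\<dots> = (\<Prod>x\<in>A - L - R. complex_of_real (l x * l' x))"
    using A by (intro prod.mono_neutral_cong_right) auto
  also have "(\<Prod>b\<in>S. if Min (fst b) \<in> L then block_inner \<xi> T (fst b) else 1) =
      (\<Prod>B\<in>\<rho>. if Min B \<in> L then block_inner \<xi> T B else 1)"
    by (rule prod.reindex_bij_betw[OF f])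
  also have "\<dots> = (\<Prod>B | B \<in> \<rho> \<and> card B \<ge> 2. block_inner \<xi> T B)"
    using fin b(7) by (intro prod.mono_neutral_cong_right) auto
  also have "(\<Prod>b\<in>S. if Min (snd b) \<in> L then block_inner \<xi>' T' (snd b) else 1) =
      (\<Prod>B\<in>\<rho>'. if Min B \<in> L then block_inner \<xi>' T' B else 1)"
    by (rule prod.reindex_bij_betw[OF s])
  also have "\<dots> = (\<Prod>B | B \<in> \<rho>' \<and> card B \<ge> 2. block_inner \<xi>' T' B)"
    using fin b'(7) by (intro prod.mono_neutral_cong_right) auto
  finally show ?thesis by (simp add: S_def)
qed

definition arc_starts :: "nat set set \<Rightarrow> nat set" where
  "arc_starts \<rho> = (\<Union>B\<in>\<rho>. B - {Max B})"

definition arc_ends :: "nat set set \<Rightarrow> nat set" where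
  "arc_ends \<rho> = (\<Union>B\<in>\<rho>. B - {Min B})"

lemma typed_partitions_iff:
  assumes "L \<subseteq> A" "R \<subseteq> A"
  shows "\<rho> \<in> typed_partitions L R A \<longleftrightarrow> partition_on A \<rho> \<and> arc_starts \<rho> = L \<and> arc_ends \<rho> = R"
proof (intro iffI conjI)
  assume l: "\<rho> \<in> typed_partitions L R A"
  then show part: "partition_on A \<rho>" by (simp add: typed_partitions_def)
  have "arc_starts \<rho> = (\<Union>B\<in>\<rho>. B \<inter> L)" "arc_ends \<rho> = (\<Union>B\<in>\<rho>. B \<inter> R)"
    using l by (auto simp: typed_partitions_def closed_block_def arc_starts_def arc_ends_def)
  then show "arc_starts \<rho> = L" "arc_ends \<rho> = R"
    using assms part by (auto simp: partition_on_def)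
next
  assume r: "partition_on A \<rho> \<and> arc_starts \<rho> = L \<and> arc_ends \<rho> = R"
  have "B \<inter> arc_starts \<rho> = B - {Max B}" "B \<inter> arc_ends \<rho> = B - {Min B}" if "B \<in> \<rho>" for B
  proof -
    have "B = B'" if "B' \<in> \<rho>" "x \<in> B" "x \<in> B'" for B' x
      using r that \<open>B \<in> \<rho>\<close> by (auto simp: partition_on_def disjoint_def)
    then show "B \<inter> arc_starts \<rho> = B - {Max B}" "B \<inter> arc_ends \<rho> = B - {Min B}"
      using that unfolding arc_starts_def arc_ends_def by blast+
  qed
  then show "\<rho> \<in> typed_partitions L R A"
    using r by (auto simp: typed_partitions_def closed_block_def)
qed

text \<open>
  The pair \<open>(L, R)\<close> carries the same information as the openers, middle points and singletons.
\<close>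

lemma point_kinds_typed:
  assumes "finite A" "\<rho> \<in> typed_partitions L R A" "L \<subseteq> A" "R \<subseteq> A"
  shows "openers \<rho> = L - R" "middle_points \<rho> = L \<inter> R" "singletons \<rho> = A - L - R"
proof -
  note b = typed_block[OF assms(1,2)]
  have ex: "\<exists>B\<in>\<rho>. x \<in> B" if "x \<in> A" for x
    using assms(2) that by (auto simp: typed_partitions_def partition_on_def)
  show "openers \<rho> = L - R"
  proof (intro equalityI subsetI)
    fix x assume "x \<in> openers \<rho>"
    then show "x \<in> L - R" using b(2,6,7) by (auto simp: openers_def)
  next
    fix x assume x: "x \<in> L - R"
    then obtain B where B: "B \<in> \<rho>" "x \<in> B" using ex assms(3) by blast
    then have "x = Min B" using x b(6)[OF B(1)] by blast
    then show "x \<in> openers \<rho>" using B(1) x b(7)[OF B(1)] by (auto simp: openers_def)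
  qed
  show "middle_points \<rho> = L \<inter> R"
  proof (intro equalityI subsetI)
    fix x assume "x \<in> middle_points \<rho>"
    then obtain B where "B \<in> \<rho>" "x \<in> B" "x \<noteq> Min B" "x \<noteq> Max B" by (auto simp: middle_points_def)
    then show "x \<in> L \<inter> R" using b(5,6)[of B] by blast
  next
    fix x assume x: "x \<in> L \<inter> R"
    then obtain B where B: "B \<in> \<rho>" "x \<in> B" using ex assms(3) by blast
    then have "x \<noteq> Min B" "x \<noteq> Max B" using x b(5,6)[OF B(1)] by blast+
    moreover from this have "card B \<noteq> 1" using B(2) b(2)[OF B(1)] by (auto simp: card_1_singleton_iff)
    ultimately show "x \<in> middle_points \<rho>"
      using B b(7,8)[OF B(1)] unfolding middle_points_def by blast
  qed
  show "singletons \<rho> = A - L - R"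
  proof (intro equalityI subsetI)
    fix x assume "x \<in> singletons \<rho>"
    then have "{x} \<in> \<rho>" by (simp add: singletons_def)
    from b(4,5,6)[OF this] show "x \<in> A - L - R" by auto
  next
    fix x assume x: "x \<in> A - L - R"
    then obtain B where B: "B \<in> \<rho>" "x \<in> B" using ex by blast
    then have "x = Min B" "x = Max B" using x b(5,6)[OF B(1)] by blast+
    then have "B = {x}" using b(9)[OF B(1)] by simp
    then show "x \<in> singletons \<rho>" using B(1) by (simp add: singletons_def)
  qed
qed

definition join_parts :: "nat set set \<Rightarrow> nat set set \<Rightarrow> (nat + nat) set set" where
  "join_parts \<rho> \<rho>' = (`) Inl ` \<rho> \<union> (`) Inr ` \<rho>'"

lemma parts_eq:
  "left_part \<pi> = (-`) Inl ` \<pi> - {{}}" "right_part \<pi> = (-`) Inr ` \<pi> - {{}}"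
  by (simp_all add: left_part_def right_part_def setcompr_eq_image)

lemma partition_on_parts:
  assumes "partition_on (A <+> A) \<pi>"
  shows "partition_on A (left_part \<pi>)" "partition_on A (right_part \<pi>)"
proof -
  have "Inl -` (A <+> A) = A" "Inr -` (A <+> A) = A" by auto
  then show "partition_on A (left_part \<pi>)" "partition_on A (right_part \<pi>)"
    using partition_on_vimage[OF assms, of Inl] partition_on_vimage[OF assms, of Inr]
    by (simp_all add: parts_eq)
qed

lemma parts_join:
  assumes "{} \<notin> \<rho>" "{} \<notin> \<rho>'"
  shows "left_part (join_parts \<rho> \<rho>') = \<rho>" "right_part (join_parts \<rho> \<rho>') = \<rho>'"
proof -
  have "(Inl :: nat \<Rightarrow> nat + nat) -` Inl ` X = X" "(Inr :: nat \<Rightarrow> nat + nat) -` Inr ` X = X"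
    "(Inl :: nat \<Rightarrow> nat + nat) -` Inr ` X = {}" "(Inr :: nat \<Rightarrow> nat + nat) -` Inl ` X = {}" for X :: "nat set"
    by (auto simp: vimage_def)
  then show "left_part (join_parts \<rho> \<rho>') = \<rho>" "right_part (join_parts \<rho> \<rho>') = \<rho>'"
    using assms unfolding parts_eq join_parts_def image_Un image_image
    by (auto simp: image_constant_conv)
qed

lemma partition_on_join:
  assumes "partition_on A \<rho>" "partition_on A \<rho>'"
  shows "partition_on (A <+> A) (join_parts \<rho> \<rho>')"
proof (rule partition_onI)
  have "\<Union>(join_parts \<rho> \<rho>') = Inl ` \<Union>\<rho> \<union> Inr ` \<Union>\<rho>'"
    unfolding join_parts_def by blast
  then show "\<Union>(join_parts \<rho> \<rho>') = A <+> A"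
    using assms[THEN partition_onD1] by (simp add: Plus_def)
  show "{} \<notin> join_parts \<rho> \<rho>'" using assms by (auto simp: join_parts_def partition_on_def)
  have dj: "X \<inter> Y = {}" if "X \<in> \<rho> \<and> Y \<in> \<rho> \<or> X \<in> \<rho>' \<and> Y \<in> \<rho>'" "X \<noteq> Y" for X Y
    using that assms[THEN partition_onD2] by (metis disjointD)
  fix p p' assume p: "p \<in> join_parts \<rho> \<rho>'" "p' \<in> join_parts \<rho> \<rho>'" "p \<noteq> p'"
  from p(1,2) consider X Y where "X \<in> \<rho> \<and> Y \<in> \<rho>" "p = Inl ` X" "p' = Inl ` Y"
    | X Y where "X \<in> \<rho>' \<and> Y \<in> \<rho>'" "p = Inr ` X" "p' = Inr ` Y"
    | X Y where "p = Inl ` X" "p' = Inr ` Y" | X Y where "p = Inr ` X" "p' = Inl ` Y"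
    unfolding join_parts_def by (elim UnE imageE) metis+
  then show "disjnt p p'"
  proof cases
    case 1
    then have "X \<inter> Y = {}" using dj[of X Y] p(3) by blast
    then show ?thesis using 1(2,3) by (auto simp: disjnt_def)
  next
    case 2
    then have "X \<inter> Y = {}" using dj[of X Y] p(3) by blast
    then show ?thesis using 2(2,3) by (auto simp: disjnt_def)
  qed (auto simp: disjnt_def)
qed

lemma join_left_right:
  assumes "\<And>B. B \<in> \<pi> \<Longrightarrow> B \<subseteq> range Inl \<or> B \<subseteq> range Inr" "{} \<notin> \<pi>"
  shows "join_parts (left_part \<pi>) (right_part \<pi>) = \<pi>"
proof (intro equalityI subsetI)
  fix B assume "B \<in> join_parts (left_part \<pi>) (right_part \<pi>)"
  then consider C where "C \<in> \<pi>" "B = Inl ` (Inl -` C)" "Inl -` C \<noteq> {}" | C where "C \<in> \<pi>" "B = Inr ` (Inr -` C)" "Inr -` C \<noteq> {}"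
    unfolding join_parts_def left_part_def right_part_def by blast
  then show "B \<in> \<pi>"
  proof cases
    case 1
    then have "C \<subseteq> range Inl" using assms(1)[of C] by auto
    then have "B = C" using 1(2) by auto
    then show ?thesis using 1 by simp
  next
    case 2
    then have "C \<subseteq> range Inr" using assms(1)[of C] by auto
    then have "B = C" using 2(2) by auto
    then show ?thesis using 2 by simp
  qed
next
  fix B assume B: "B \<in> \<pi>"
  from assms(1)[OF B] show "B \<in> join_parts (left_part \<pi>) (right_part \<pi>)"
  proof
    assume "B \<subseteq> range Inl"
    then have eq: "Inl ` (Inl -` B) = B" by auto
    moreover have "Inl -` B \<noteq> {}" using eq assms(2) B by (metis image_empty)
    ultimately have "Inl -` B \<in> left_part \<pi>" using B by (auto simp: parts_eq)
    then show ?thesis using eq[symmetric] unfolding join_parts_def by (intro UnI1 image_eqI)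
  next
    assume "B \<subseteq> range Inr"
    then have eq: "Inr ` (Inr -` B) = B" by auto
    moreover have "Inr -` B \<noteq> {}" using eq assms(2) B by (metis image_empty)
    ultimately have "Inr -` B \<in> right_part \<pi>" using B by (auto simp: parts_eq)
    then show ?thesis using eq[symmetric] unfolding join_parts_def by (intro UnI2 image_eqI)
  qed
qed

lemma arc_sets_from_kinds:
  assumes "finite A" "partition_on A \<rho>"
  shows "\<rho> \<in> typed_partitions (arc_starts \<rho>) (arc_ends \<rho>) A" "arc_starts \<rho> \<subseteq> A" "arc_ends \<rho> \<subseteq> A"
    "arc_starts \<rho> = openers \<rho> \<union> middle_points \<rho>" "arc_ends \<rho> = A - openers \<rho> - singletons \<rho>"
proof -
  show sub: "arc_starts \<rho> \<subseteq> A" "arc_ends \<rho> \<subseteq> A"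
    using assms(2) by (auto simp: arc_starts_def arc_ends_def partition_on_def)
  then show t: "\<rho> \<in> typed_partitions (arc_starts \<rho>) (arc_ends \<rho>) A"
    using assms(2) by (simp add: typed_partitions_iff)
  show "arc_starts \<rho> = openers \<rho> \<union> middle_points \<rho>" "arc_ends \<rho> = A - openers \<rho> - singletons \<rho>"
    using point_kinds_typed[OF assms(1) t sub] sub by auto
qed

text \<open>
  Cutting a diagonal partition into its two halves identifies diagonal partitions with pairs of
  partitions of the same type \<open>(L, R)\<close>.
\<close>

lemma sum_diag_partitions:
  fixes g :: "nat set set \<Rightarrow> nat set set \<Rightarrow> complex" and n :: nat
  defines "A \<equiv> {1..n}"
  shows "(\<Sum>\<pi>\<in>diag_partitions n. g (left_part \<pi>) (right_part \<pi>)) =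
    (\<Sum>L\<in>Pow A. \<Sum>R\<in>Pow A. \<Sum>\<rho>\<in>typed_partitions L R A. \<Sum>\<rho>'\<in>typed_partitions L R A. g \<rho> \<rho>')"
proof -
  have A: "finite A" by (simp add: A_def)
  have fin: "finite (typed_partitions L R A)" for L R
    by (rule finite_subset[OF _ finitely_many_partition_on[OF A]]) (auto simp: typed_partitions_def)
  let ?I = "SIGMA (L, R):Pow A \<times> Pow A. typed_partitions L R A \<times> typed_partitions L R A"
  have "(\<Sum>L\<in>Pow A. \<Sum>R\<in>Pow A. \<Sum>\<rho>\<in>typed_partitions L R A. \<Sum>\<rho>'\<in>typed_partitions L R A. g \<rho> \<rho>') =
      (\<Sum>p\<in>Pow A \<times> Pow A. \<Sum>s\<in>(case p of (L, R) \<Rightarrow> typed_partitions L R A \<times> typed_partitions L R A). g (fst s) (snd s))"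
    by (simp add: sum.cartesian_product case_prod_unfold)
  also have "\<dots> = (\<Sum>(p, s)\<in>?I. g (fst s) (snd s))"
    using A fin by (intro sum.Sigma) auto
  also have "\<dots> = (\<Sum>\<pi>\<in>diag_partitions n. g (left_part \<pi>) (right_part \<pi>))"
  proof (rule sum.reindex_bij_witness[where j = "\<lambda>(p, \<rho>, \<rho>'). join_parts \<rho> \<rho>'"
        and i = "\<lambda>\<pi>. ((arc_starts (left_part \<pi>), arc_ends (left_part \<pi>)), left_part \<pi>, right_part \<pi>)"], goal_cases)
    case (1 a)
    then obtain L R \<rho> \<rho>' where a: "a = ((L, R), \<rho>, \<rho>')" "L \<subseteq> A" "R \<subseteq> A"
      "\<rho> \<in> typed_partitions L R A" "\<rho>' \<in> typed_partitions L R A" by auto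
    then have "{} \<notin> \<rho>" "{} \<notin> \<rho>'" by (auto simp: typed_partitions_def partition_on_def)
    then show ?case using a by (simp add: parts_join typed_partitions_iff)
  next
    case (2 a)
    then obtain L R \<rho> \<rho>' where a: "a = ((L, R), \<rho>, \<rho>')" "L \<subseteq> A" "R \<subseteq> A"
      "\<rho> \<in> typed_partitions L R A" "\<rho>' \<in> typed_partitions L R A" by auto
    then have part: "partition_on A \<rho>" "partition_on A \<rho>'" by (auto simp: typed_partitions_def)
    then have ne: "{} \<notin> \<rho>" "{} \<notin> \<rho>'" by (auto simp: partition_on_def)
    have "\<forall>B\<in>join_parts \<rho> \<rho>'. B \<subseteq> range Inl \<or> B \<subseteq> range Inr" by (auto simp: join_parts_def)
    then show ?case
      using partition_on_join[OF part] point_kinds_typed[OF A a(4,2,3)] point_kinds_typed[OF A a(5,2,3)]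
      by (simp add: a(1) diag_partitions_def parts_join[OF ne] A_def)
  next
    case (3 \<pi>)
    then show ?case
      by (auto simp: diag_partitions_def partition_on_def intro!: join_left_right)
  next
    case (4 \<pi>)
    then have "partition_on (A <+> A) \<pi>" by (simp add: diag_partitions_def A_def)
    note p = partition_on_parts[OF this]
    note l = arc_sets_from_kinds[OF A p(1)] and r = arc_sets_from_kinds[OF A p(2)]
    have "arc_starts (right_part \<pi>) = arc_starts (left_part \<pi>)" "arc_ends (right_part \<pi>) = arc_ends (left_part \<pi>)"
      using 4 l(4,5) r(4,5) by (simp_all add: diag_partitions_def)
    then show ?case using l r(1) by simp
  next
    case (5 a)
    then obtain L R \<rho> \<rho>' where a: "a = ((L, R), \<rho>, \<rho>')"
      "\<rho> \<in> typed_partitions L R A" "\<rho>' \<in> typed_partitions L R A" by auto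
    then have "{} \<notin> \<rho>" "{} \<notin> \<rho>'" by (auto simp: typed_partitions_def partition_on_def)
    then show ?case using a by (simp add: parts_join)
  qed
  finally show ?thesis by simp
qed

lemma foldr_comp_apply: "foldr (\<circ>) (map f xs) id x = foldr f xs x"
  by (induction xs) auto

theorem theorem5p6:
  fixes q t v w :: real and n :: nat
    and D :: "'a::{real_inner, polish_space} cplx set"
    and D' :: "'b::{real_inner, polish_space} cplx set"
    and \<xi> :: "nat \<Rightarrow> 'a cplx" and \<xi>' :: "nat \<Rightarrow> 'b cplx"
    and T :: "nat \<Rightarrow> 'a cplx \<Rightarrow> 'a cplx" and T' :: "nat \<Rightarrow> 'b cplx \<Rightarrow> 'b cplx"
    and l l' :: "nat \<Rightarrow> real"
  assumes "\<bar>q\<bar> \<le> t" "t \<le> 1" "\<bar>v\<bar> \<le> w" "w \<le> 1" and "n \<ge> 1"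
    and "cplx.subspace D" "closure D = UNIV"
    and "cplx.subspace D'" "closure D' = UNIV"
    and "\<And>i. i \<in> {1..n} \<Longrightarrow> \<xi> i \<in> real_vectors \<inter> D"
    and "\<And>i. i \<in> {1..n} \<Longrightarrow> \<xi>' i \<in> real_vectors \<inter> D'"
    and "\<And>i. i \<in> {1..n} \<Longrightarrow> operator_on D (T i)"
    and "\<And>i. i \<in> {1..n} \<Longrightarrow> operator_on D' (T' i)"
  shows "vacuum_state q t v w
      (foldr (\<circ>) (map (\<lambda>i. field_op q t v w D D' (\<xi> i) (\<xi>' i) (T i) (T' i) (l i) (l' i)) [1..<n + 1]) id) =
    (\<Sum>\<pi>\<in>diag_partitions n.
       of_real (q ^ rc (left_part \<pi>) * t ^ rnest (left_part \<pi>) *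
                v ^ rc (right_part \<pi>) * w ^ rnest (right_part \<pi>)) *
       partition_weight \<xi> \<xi>' T T' l l' \<pi>)"
proof -
  define A where "A = {1..n}"
  interpret fock_setting q t v w D D' \<xi> \<xi>' T T' l l' A
    using assms(6,8,10-13) by unfold_locales (auto simp: A_def)
  have A: "finite A" by (simp add: A_def)
  have "[1..<n + 1] = sorted_list_of_set A"
    unfolding A_def by (metis Suc_eq_plus1 atLeastLessThanSuc_atLeastAtMost sorted_list_of_set_range)
  then have "vacuum_state q t v w (foldr (\<circ>) (map field [1..<n + 1]) id) = state A ([], [])"
    unfolding vacuum_state_def foldr_comp_apply
    by (simp only: foldr_field_op[OF A subset_refl] fock_form_vacuum_state[OF A subset_refl])
  also have "\<dots> = (\<Sum>L\<in>Pow A. \<Sum>R\<in>Pow A. \<Sum>\<rho>\<in>typed_partitions L R A. \<Sum>\<rho>'\<in>typed_partitions L R A.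
      (\<Prod>x\<in>A - L - R. of_real (l x * l' x)) * (partition_amp q t \<xi> T \<rho> * partition_amp v w \<xi>' T' \<rho>'))"
    unfolding fock_sum_def prod.case config_sum_vacuum[OF A] sum_product
    unfolding sum_distrib_left by (rule refl)
  also have "\<dots> = (\<Sum>L\<in>Pow A. \<Sum>R\<in>Pow A. \<Sum>\<rho>\<in>typed_partitions L R A. \<Sum>\<rho>'\<in>typed_partitions L R A.
      of_real (q ^ rc \<rho> * t ^ rnest \<rho> * v ^ rc \<rho>' * w ^ rnest \<rho>') *
      (\<Prod>b | fst b \<in> \<rho> \<and> snd b \<in> \<rho>' \<and> Min (fst b) = Min (snd b). block_weight \<xi> \<xi>' T T' l l' b))"
    by (intro sum.cong refl) (simp add: prod_matched_blocks[OF A] partition_amp_def mult_ac)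
  also have "\<dots> = (\<Sum>\<pi>\<in>diag_partitions n.
       of_real (q ^ rc (left_part \<pi>) * t ^ rnest (left_part \<pi>) *
                v ^ rc (right_part \<pi>) * w ^ rnest (right_part \<pi>)) *
       partition_weight \<xi> \<xi>' T T' l l' \<pi>)"
    unfolding A_def sum_diag_partitions[symmetric]
    by (simp add: partition_weight_def diag_blocks_def case_prod_unfold)
  finally show ?thesis .
qed

end
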